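(* Let $p$ be a prime and let $(A,\mathfrak m)$ be a finite commutative local ring with $1$ whose characteristic is a power of $p$. Then $$A^*\cong \mathbb F_{p^\lambda}^*\times H,$$ where $\lambda\ge 1$ is such that $A/\mathfrak m\cong\mathbb F_{p^\lambda}$ and $H=1+\mathfrak m$ is an abelian $p$-group. Moreover, the filtration $\{1+\mathfrak m^i\}_{i\ge 1}$ of $H$ has the property that all its quotients $(1+\mathfrak m^i)/(1+\mathfrak m^{i+1})$ are $\mathbb F_{p^\lambda}$-vector spaces (i.e. are isomorphic, as abelian groups, to the additive group of an $\mathbb F_{p^\lambda}$-vector space), and $|H|=p^{\lambda k}$ for some integer $k\ge 0$. Conversely, for each prime $p$, each integer $\lambda\ge 1$ and each integer $k\ge 0$ there exists a finite commutative local (artinian) ring $A$ with characteristic a power of $p$ such that $A^*\cong\mathbb F_{p^\lambda}^*\times H$, where $H$ is an abelian $p$-group with $|H|=p^{\lambda k}$. Finally, the groups (up to isomorphism) that occur as groups of units of reduced finite commutative local (artinian) rings are precisely the multiplicative groups of finite fields.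
   Context: $A^*$ denotes the group of units of a ring $A$. A ring is called reduced if it has no non-zero nilpotent elements. $\mathbb F_{q}$ denotes the finite field with $q$ elements. For a local ring $(A,\mathfrak m)$, $\mathfrak m$ is its maximal ideal. *)

theory Defs
  imports "HOL-Algebra.Algebra" "HOL-Computational_Algebra.Primes"
begin

definition local_ring :: "('a, 'm) ring_scheme \<Rightarrow> 'a set \<Rightarrow> bool"
  where "local_ring A \<mm> \<longleftrightarrow>
    cring A \<and> maximalideal \<mm> A \<and> (\<forall>M. maximalideal M A \<longrightarrow> M = \<mm>)"

text \<open>The additive order of \<open>\<one>\<close>, where \<^const>\<open>group.ord\<close> is \<open>0\<close> on elements of infinite order.\<close>
definition ring_char :: "('a, 'm) ring_scheme \<Rightarrow> nat"
  where "ring_char R = group.ord (add_monoid R) \<one>\<^bsub>R\<^esub>"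

definition reduced_ring :: "('a, 'm) ring_scheme \<Rightarrow> bool"
  where "reduced_ring R \<longleftrightarrow>
    (\<forall>x \<in> carrier R. \<forall>n::nat. x [^]\<^bsub>R\<^esub> n = \<zero>\<^bsub>R\<^esub> \<longrightarrow> x = \<zero>\<^bsub>R\<^esub>)"

text \<open>The field with \<open>q\<close> elements is only determined up to isomorphism, so a representative with
  carrier in \<^typ>\<open>nat\<close> is chosen. Meaningful only when \<open>q\<close> is a prime power.\<close>
definition GF :: "nat \<Rightarrow> nat ring"
  where "GF q = (SOME F. field F \<and> finite (carrier F) \<and> card (carrier F) = q)"

definition p_group :: "nat \<Rightarrow> ('a, 'm) monoid_scheme \<Rightarrow> bool"
  where "p_group p G \<longleftrightarrow>
    group G \<and> (\<forall>x \<in> carrier G. \<exists>n::nat. group.ord G x = p ^ n)"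

text \<open>\<^const>\<open>module\<close> ignores the multiplication of its second argument, so \<open>V\<close> carries only an
  abelian group structure and a scalar multiplication.\<close>
definition is_vector_space :: "('a, 'm) ring_scheme \<Rightarrow> ('a, 'b, 'n) module_scheme \<Rightarrow> bool"
  where "is_vector_space K V \<longleftrightarrow> field K \<and> module K V"

text \<open>The set \<open>1 + I\<close> with the multiplication of the unit group.\<close>
definition one_plus :: "('a, 'm) ring_scheme \<Rightarrow> 'a set \<Rightarrow> 'a monoid"
  where "one_plus R I = (units_of R)\<lparr>carrier := (\<lambda>x. \<one>\<^bsub>R\<^esub> \<oplus>\<^bsub>R\<^esub> x) ` I\<rparr>"

text \<open>The \<open>i\<close>-th power of an ideal, taken in the commutative monoid of ideals of \<open>R\<close>.\<close>
abbreviation ideal_pow :: "('a, 'm) ring_scheme \<Rightarrow> 'a set \<Rightarrow> nat \<Rightarrow> 'a set"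
  where "ideal_pow R I i \<equiv> I [^]\<^bsub>ideals_set R\<^esub> i"

end

theory Submission
  imports Defs "HOL-Number_Theory.Residues"
begin

text \<open>
  Let \<open>A\<close> be a finite local ring with maximal ideal \<open>\<mm>\<close>, residue field \<open>k\<close> of order \<open>q\<close> and
  characteristic a power of \<open>p\<close>. The units are the elements outside \<open>\<mm>\<close>. Since \<open>p\<close> is nilpotent,
  both \<open>k\<close> and \<open>\<mm>\<close> have order a power of \<open>p\<close>, so \<open>H = 1 + \<mm>\<close>, which has as many elements as \<open>\<mm>\<close>,
  is a \<open>p\<close>-group, whereas the units of \<open>k\<close> form a group of order \<open>q - 1\<close> prime to \<open>p\<close>. The map that
  sends a unit \<open>x\<close> to the pair of its residue class and its power of exponent \<open>q - 1\<close> is therefore an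
  injective homomorphism into the product of the units of \<open>k\<close> with \<open>H\<close>, and a count shows that it is
  an isomorphism (\<open>unit_decomposition_iso\<close>).

  The preimage of the first factor acts freely on \<open>\<mm> - {0}\<close>, so \<open>q - 1\<close> divides \<open>|\<mm>| - 1\<close>. With
  \<open>q = p\<^sup>\<lambda>\<close> and \<open>|\<mm>| = p\<^sup>s\<close> this forces \<open>\<lambda>\<close> to divide \<open>s\<close>
  (\<open>residue_units_dvd_card_maximal_ideal\<close>, \<open>dvd_power_diff_one_imp_dvd\<close>). The successive quotients of
  the filtration by powers \<open>I\<close> of \<open>\<mm>\<close> are isomorphic to \<open>I / \<mm>I\<close> by subtracting \<open>1\<close>, and \<open>A\<close> acts on
  \<open>I / \<mm>I\<close> through \<open>k\<close> (\<open>quotient_space_vector_space\<close>, \<open>one_plus_quotient_iso\<close>).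

  The statement names one particular field with \<open>p\<^sup>\<lambda>\<close> elements, so that the existence and uniqueness
  of finite fields are needed (\<open>exists_finite_field\<close>, \<open>finite_fields_iso\<close>). Existence comes from the
  fixed points of a power of the Frobenius map on an algebraic closure of the prime field. Uniqueness
  comes from a root count for the minimal polynomial of a generator of the multiplicative group.

  For the converse, the trivial extension of the field \<open>F\<close> with \<open>p\<^sup>\<lambda>\<close> elements by the module \<open>F\<^sup>k\<close> is
  local with a maximal ideal of \<open>p\<close> to the \<open>\<lambda>k\<close> elements (\<open>exists_local_ring\<close>). Finally, the maximal
  ideal of a finite local ring consists of nilpotent elements, so a reduced one is a field.
\<close>

section \<open>Ring isomorphisms and units\<close>

lemma ring_hom_Units:
  assumes "ring R" "ring S" and h: "h \<in> ring_hom R S" and x: "x \<in> Units R"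
  shows "h x \<in> Units S"
proof -
  from x obtain y where y: "x \<in> carrier R" "y \<in> carrier R"
    "y \<otimes>\<^bsub>R\<^esub> x = \<one>\<^bsub>R\<^esub>" "x \<otimes>\<^bsub>R\<^esub> y = \<one>\<^bsub>R\<^esub>"
    unfolding Units_def by auto
  then have "h y \<otimes>\<^bsub>S\<^esub> h x = \<one>\<^bsub>S\<^esub>" "h x \<otimes>\<^bsub>S\<^esub> h y = \<one>\<^bsub>S\<^esub>"
    using ring_hom_mult[OF h] ring_hom_one[OF h] by metis+
  then show ?thesis
    unfolding Units_def using ring_hom_closed[OF h] y by auto
qed

lemma Units_subset: "Units R \<subseteq> carrier R"
  by (auto simp: Units_def)

lemma ring_iso_imp_units_iso:
  assumes "ring R" "ring S" "R \<simeq> S"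
  shows "units_of R \<cong> units_of S"
proof -
  obtain h where h: "h \<in> ring_iso R S"
    using assms(3) unfolding is_ring_iso_def by auto
  have hom: "h \<in> ring_hom R S" and bij: "bij_betw h (carrier R) (carrier S)"
    using h unfolding ring_iso_def by auto
  have inv: "inv_into (carrier R) h \<in> ring_hom S R"
    using ring_iso_set_sym[OF assms(1) h] unfolding ring_iso_def by auto
  have "h ` Units R = Units S"
  proof
    show "h ` Units R \<subseteq> Units S"
      using ring_hom_Units[OF assms(1,2) hom] by auto
    show "Units S \<subseteq> h ` Units R"
    proof
      fix y assume y: "y \<in> Units S"
      then have "y \<in> carrier S" unfolding Units_def by auto
      then have "h (inv_into (carrier R) h y) = y"
        using bij by (simp add: bij_betw_inv_into_right)
      then show "y \<in> h ` Units R"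
        using ring_hom_Units[OF assms(2,1) inv y] by force
    qed
  qed
  moreover have "inj_on h (Units R)"
    using bij unfolding bij_betw_def Units_def by (auto intro: inj_on_subset)
  moreover have "h (x \<otimes>\<^bsub>R\<^esub> y) = h x \<otimes>\<^bsub>S\<^esub> h y" if "x \<in> Units R" "y \<in> Units R" for x y
    using that Units_subset[of R] by (intro ring_hom_mult[OF hom]) auto
  ultimately have "h \<in> iso (units_of R) (units_of S)"
    unfolding iso_def hom_def bij_betw_def
    by (auto simp: units_of_carrier units_of_mult)
  then show ?thesis unfolding is_iso_def by auto
qed

text \<open>Representatives with carrier in \<^typ>\<open>nat\<close> exist for all finite rings; this makes the
  choice of carrier type in the existence statements immaterial.\<close>

lemma finite_ring_iso_nat_ring:
  assumes "ring R" "finite (carrier R)"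
  obtains S :: "nat ring" where "ring S" "finite (carrier S)" "R \<simeq> S"
proof -
  obtain f :: "'a \<Rightarrow> nat" where f: "inj_on f (carrier R)"
    using finite_imp_inj_to_nat_seg[OF assms(2)] by blast
  show thesis
  proof (rule that)
    show "ring (image_ring f R)"
      by (rule ring.inj_imp_image_ring_is_ring[OF assms(1) f])
    show "finite (carrier (image_ring f R))"
      using assms(2) by (simp add: image_ring_carrier)
    show "R \<simeq> image_ring f R"
      using inj_imp_image_ring_iso[OF f] unfolding is_ring_iso_def by auto
  qed
qed

lemma ring_iso_sym: "ring R \<Longrightarrow> R \<simeq> S \<Longrightarrow> S \<simeq> R"
  unfolding is_ring_iso_def using ring_iso_set_sym by blast

lemma ring_iso_cring:
  assumes "cring R" "ring S" "R \<simeq> S"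
  shows "cring S"
proof -
  interpret R: cring R by fact
  obtain h where h: "h \<in> ring_iso R S" using assms(3) unfolding is_ring_iso_def by auto
  then have "h \<zero>\<^bsub>R\<^esub> = \<zero>\<^bsub>S\<^esub>"
    using assms(2) R.ring_axioms unfolding ring_iso_def by (auto intro!: ring_hom_zero)
  then show ?thesis using R.ring_iso_imp_img_cring[OF h] by simp
qed

lemma ring_iso_field:
  assumes "field R" "ring S" "R \<simeq> S"
  shows "field S"
proof -
  interpret R: field R by fact
  obtain h where h: "h \<in> ring_iso R S" using assms(3) unfolding is_ring_iso_def by auto
  then have "h \<zero>\<^bsub>R\<^esub> = \<zero>\<^bsub>S\<^esub>"
    using assms(2) R.ring_axioms unfolding ring_iso_def by (auto intro!: ring_hom_zero)
  then show ?thesis using R.ring_iso_imp_img_field[OF h] by simp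
qed

section \<open>The Frobenius endomorphism\<close>

lemma (in cring) binomial_expansion:
  assumes [simp]: "x \<in> carrier R" "y \<in> carrier R"
  shows "(x \<oplus> y) [^] (n::nat) =
    (\<Oplus>k\<in>{..n}. [(n choose k)] \<cdot> (x [^] k \<otimes> y [^] (n - k)))"
proof (induction n)
  case 0
  show ?case by simp
next
  case (Suc n)
  let ?t = "\<lambda>n k. [(n choose k)] \<cdot> (x [^] k \<otimes> y [^] (n - k))"
  let ?u = "\<lambda>k. [(n choose k)] \<cdot> (x [^] k \<otimes> y [^] (Suc n - k))"
  have x: "finsum R (?t n) {..n} \<otimes> x = (\<Oplus>k\<in>{..n}. [(n choose k)] \<cdot> (x [^] Suc k \<otimes> y [^] (n - k)))"
    by (subst finsum_ldistr) (auto intro!: finsum_cong' simp: add_pow_ldistr add_pow_rdistr m_ac)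
  have "finsum R (?t n) {..n} \<otimes> y = finsum R ?u {..n}"
    by (subst finsum_ldistr) (auto intro!: finsum_cong' simp: add_pow_ldistr add_pow_rdistr m_ac Suc_diff_le)
  also have "\<dots> = finsum R ?u {..Suc n}"
    by (simp add: Pi_def binomial_eq_0)
  also have "\<dots> = (\<Oplus>k\<in>{..n}. ?u (Suc k)) \<oplus> ?u 0"
    by (subst finsum_Suc2) auto
  finally have y: "finsum R (?t n) {..n} \<otimes> y = (\<Oplus>k\<in>{..n}. ?u (Suc k)) \<oplus> ?u 0" .
  have "finsum R (?t (Suc n)) {..Suc n} = (\<Oplus>k\<in>{..n}. ?t (Suc n) (Suc k)) \<oplus> ?t (Suc n) 0"
    by (subst finsum_Suc2) auto
  also have "(\<Oplus>k\<in>{..n}. ?t (Suc n) (Suc k)) =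
      (\<Oplus>k\<in>{..n}. [(n choose k)] \<cdot> (x [^] Suc k \<otimes> y [^] (n - k)) \<oplus> ?u (Suc k))"
    by (intro finsum_cong') (auto simp: add.nat_pow_mult simp del: nat_pow_Suc)
  also have "\<dots> = finsum R (?t n) {..n} \<otimes> x \<oplus> (\<Oplus>k\<in>{..n}. ?u (Suc k))"
    unfolding x by (intro finsum_addf) auto
  also have "finsum R (?t n) {..n} \<otimes> x \<oplus> (\<Oplus>k\<in>{..n}. ?u (Suc k)) \<oplus> ?t (Suc n) 0
      = finsum R (?t n) {..n} \<otimes> x \<oplus> finsum R (?t n) {..n} \<otimes> y"
    unfolding y by (subst a_assoc) (auto intro!: finsum_closed)
  also have "\<dots> = (x \<oplus> y) [^] Suc n"
    by (simp add: Suc.IH r_distr[symmetric])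
  finally show ?case by simp
qed

lemma (in cring) frobenius_add:
  fixes p :: nat
  assumes p: "Factorial_Ring.prime p" and char: "[p] \<cdot> \<one> = \<zero>"
    and [simp]: "x \<in> carrier R" "y \<in> carrier R"
  shows "(x \<oplus> y) [^] p = x [^] p \<oplus> y [^] p"
proof -
  obtain m where m: "p = Suc m" using p not0_implies_Suc by fastforce
  have vanish: "[p] \<cdot> z = \<zero>" if "z \<in> carrier R" for z
    using add_pow_ldistr[OF one_closed that, of p] that by (simp add: char)
  have mid: "[(p choose Suc k)] \<cdot> z = \<zero>" if "k < m" "z \<in> carrier R" for k z
  proof -
    have "p dvd (p choose Suc k)"
      using p that m by (intro dvd_choose_prime) auto
    then obtain c where "p choose Suc k = p * c" by blast
    then show ?thesis using that vanish by (simp flip: add.nat_pow_pow)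
  qed
  let ?t = "\<lambda>k. [(p choose k)] \<cdot> (x [^] k \<otimes> y [^] (p - k))"
  have "(x \<oplus> y) [^] p = finsum R ?t {..Suc m}"
    using binomial_expansion[of x y p] by (simp add: m)
  also have "\<dots> = ?t (Suc m) \<oplus> finsum R ?t {..m}"
    by (subst finsum_Suc) auto
  also have "finsum R ?t {..m} = ?t 0"
  proof (cases m)
    case (Suc m')
    have "finsum R ?t {..m} = finsum R (\<lambda>i. ?t (Suc i)) {..m'} \<oplus> ?t 0"
      unfolding Suc by (subst finsum_Suc2) auto
    also have "finsum R (\<lambda>i. ?t (Suc i)) {..m'} = finsum R (\<lambda>i. \<zero>) {..m'}"
      by (intro finsum_cong') (auto simp: mid Suc simp del: nat_pow_Suc)
    finally show ?thesis by simp
  qed simp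
  finally show ?thesis by (simp add: m)
qed

lemma (in cring) frobenius_pow_add:
  fixes p :: nat
  assumes "Factorial_Ring.prime p" "[p] \<cdot> \<one> = \<zero>" "x \<in> carrier R" "y \<in> carrier R"
  shows "(x \<oplus> y) [^] (p ^ n) = x [^] (p ^ n) \<oplus> y [^] (p ^ n)"
proof (induction n)
  case (Suc n)
  have "(x \<oplus> y) [^] (p ^ Suc n) = ((x \<oplus> y) [^] (p ^ n)) [^] p"
    using assms by (simp add: nat_pow_pow mult.commute)
  also have "\<dots> = (x [^] (p ^ n)) [^] p \<oplus> (y [^] (p ^ n)) [^] p"
    using assms by (simp add: Suc.IH frobenius_add)
  finally show ?case
    using assms by (simp add: nat_pow_pow mult.commute)
qed (use assms in auto)

section \<open>Existence of finite fields\<close>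

lemma ring_hom_add_pow:
  assumes "ring R" "ring S" "h \<in> ring_hom R S" "x \<in> carrier R"
  shows "h ([(n::nat)] \<cdot>\<^bsub>R\<^esub> x) = [n] \<cdot>\<^bsub>S\<^esub> (h x)"
proof -
  interpret R: ring R by fact
  interpret S: ring S by fact
  interpret h: ring_hom_ring R S h by (intro ring_hom_ringI2 assms)
  show ?thesis
    using assms(4) by (induction n) auto
qed

lemma (in residues) add_pow_one: "[(n::nat)] \<cdot> \<one> = int n mod m"
  by (induction n) (auto simp: res_add_eq res_zero_eq res_one_eq mod_simps add.commute)

lemma (in cring) add_minus_add_cancel:
  assumes "x \<in> carrier R" "y \<in> carrier R" "z \<in> carrier R"
  shows "(x \<oplus> z) \<ominus> (y \<oplus> z) = x \<ominus> y"
  using assms by algebra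

text \<open>The roots \<open>c\<close> of \<open>P = X\<^sup>q - X\<close> are simple. With \<open>t = X - c\<close>, the Frobenius identity gives
  \<open>P = t\<^sup>q - t\<close>. If \<open>t\<^sup>2\<close> divided \<open>P\<close>, cancelling one factor would make \<open>t\<close> a divisor of
  a power of \<open>t\<close> minus \<open>1\<close>, which is impossible at \<open>X = c\<close>.\<close>

lemma (in domain) simple_root_frobenius:
  fixes p n :: nat and c :: 'a
  defines "P \<equiv> X [^]\<^bsub>poly_ring R\<^esub> (p ^ n) \<ominus>\<^bsub>poly_ring R\<^esub> X"
  assumes p: "Factorial_Ring.prime p" and char: "[p] \<cdot> \<one> = \<zero>" and n: "n \<ge> 1"
  shows "P \<in> carrier (poly_ring R)" and "degree P = p ^ n"
    and "c \<in> carrier R \<Longrightarrow> eval P c = c [^] (p ^ n) \<ominus> c"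
    and "c \<in> carrier R \<Longrightarrow> c [^] (p ^ n) = c \<Longrightarrow> alg_mult P c \<le> 1"
proof -
  let ?U = "poly_ring R" and ?q = "p ^ n"
  interpret U: domain ?U by (rule univ_poly_is_domain[OF carrier_is_subring])
  have X[simp]: "X \<in> carrier ?U" using var_closed(1)[OF carrier_is_subring] .
  have q: "?q \<ge> 2"
    using self_le_power[of p n] prime_ge_2_nat[OF p] n by linarith
  show P: "P \<in> carrier ?U" by (simp add: P_def)
  let ?A = "X [^]\<^bsub>?U\<^esub> ?q" and ?B = "\<ominus>\<^bsub>?U\<^esub> X"
  have A: "degree ?A = ?q"
    unfolding unitary_monom_eq_var_pow[OF carrier_is_subring, symmetric] by (simp add: monom_def)
  have B: "degree ?B = 1"
    using univ_poly_a_inv_degree[OF carrier_is_subring X] by (simp add: var_def)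
  have "polynomial (carrier R) ?A" "polynomial (carrier R) ?B"
    unfolding univ_poly_carrier using X by simp_all
  then have "degree (poly_add ?A ?B) = max (degree ?A) (degree ?B)"
    by (rule poly_add_degree_eq[OF carrier_is_subring]) (use A B q in linarith)
  then show deg: "degree P = ?q"
    using q unfolding P_def a_minus_def univ_poly_add A B by linarith
  {
    fix c assume c: "c \<in> carrier R"
    interpret ev: ring_hom_ring ?U R "\<lambda>f. eval f c"
      by (intro ring_hom_ringI2 U.ring_axioms ring_axioms eval_is_hom[OF carrier_is_subring c])
    show "eval P c = c [^] ?q \<ominus> c"
      using c by (simp add: P_def a_minus_def ev.hom_nat_pow eval_var)
  }
  show "alg_mult P c \<le> 1" if c: "c \<in> carrier R" and cq: "c [^] ?q = c"
  proof (rule ccontr)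
    let ?t = "[\<one>, \<ominus> c]" and ?k = "poly_of_const c"
    assume "\<not> alg_mult P c \<le> 1"
    then have "(?t [^]\<^bsub>?U\<^esub> (2::nat)) pdivides P"
      using le_alg_mult_imp_pdivides[OF c P] by simp
    then obtain s where s: "s \<in> carrier ?U" "P = ?t [^]\<^bsub>?U\<^esub> (2::nat) \<otimes>\<^bsub>?U\<^esub> s"
      unfolding pdivides_def factor_def by auto
    interpret k: ring_hom_ring R ?U poly_of_const
      using canonical_embedding_ring_hom[OF carrier_is_subring] by simp
    interpret ev: ring_hom_ring ?U R "\<lambda>f. eval f c"
      by (intro ring_hom_ringI2 U.ring_axioms ring_axioms eval_is_hom[OF carrier_is_subring c])
    have t: "?t \<in> carrier ?U"
      using c by (simp add: univ_poly_carrier[symmetric] polynomial_def)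
    have k[simp]: "?k \<in> carrier ?U" using c by simp
    have "[p] \<cdot>\<^bsub>?U\<^esub> \<one>\<^bsub>?U\<^esub> = poly_of_const ([p] \<cdot> \<one>)"
      using ring_hom_add_pow[OF ring_axioms U.ring_axioms k.homh, of \<one> p] by simp
    then have charU: "[p] \<cdot>\<^bsub>?U\<^esub> \<one>\<^bsub>?U\<^esub> = \<zero>\<^bsub>?U\<^esub>"
      by (simp add: char)
    have Xt: "X = ?t \<oplus>\<^bsub>?U\<^esub> ?k"
      using c by (auto simp: var_def univ_poly_add poly_of_const_def l_neg)
    have "X [^]\<^bsub>?U\<^esub> ?q = ?t [^]\<^bsub>?U\<^esub> ?q \<oplus>\<^bsub>?U\<^esub> ?k [^]\<^bsub>?U\<^esub> ?q"
      unfolding Xt by (rule U.frobenius_pow_add[OF p charU t k])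
    also have "?k [^]\<^bsub>?U\<^esub> ?q = ?k"
      using k.hom_nat_pow[OF c, of ?q] cq by simp
    finally have "P = (?t [^]\<^bsub>?U\<^esub> ?q \<oplus>\<^bsub>?U\<^esub> ?k) \<ominus>\<^bsub>?U\<^esub> (?t \<oplus>\<^bsub>?U\<^esub> ?k)"
      unfolding P_def by (simp only: Xt[symmetric])
    then have Pt: "P = ?t [^]\<^bsub>?U\<^esub> ?q \<ominus>\<^bsub>?U\<^esub> ?t"
      by (simp only: U.add_minus_add_cancel[OF U.nat_pow_closed[OF t] t k])
    define r where "r = ?t [^]\<^bsub>?U\<^esub> (?q - 1)"
    have r: "r \<in> carrier ?U" unfolding r_def using t by simp
    have "?t [^]\<^bsub>?U\<^esub> ?q = ?t \<otimes>\<^bsub>?U\<^esub> r"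
      unfolding r_def using U.nat_pow_Suc2[OF t, of "?q - 1"] q
      by (metis Suc_diff_1 less_le_trans pos2)
    then have "?t \<otimes>\<^bsub>?U\<^esub> (r \<ominus>\<^bsub>?U\<^esub> \<one>\<^bsub>?U\<^esub>) = P"
      unfolding Pt using t r by (simp add: a_minus_def U.r_distr U.r_minus)
    also have "P = ?t \<otimes>\<^bsub>?U\<^esub> (?t \<otimes>\<^bsub>?U\<^esub> s)"
      using s t by (simp add: numeral_2_eq_2 U.m_assoc)
    finally have "r \<ominus>\<^bsub>?U\<^esub> \<one>\<^bsub>?U\<^esub> = ?t \<otimes>\<^bsub>?U\<^esub> s"
      using t r s(1) by (subst (asm) U.m_lcancel) (auto simp: univ_poly_zero)
    then have "eval (r \<ominus>\<^bsub>?U\<^esub> \<one>\<^bsub>?U\<^esub>) c = eval ?t c \<otimes> eval s c"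
      using t s(1) by (metis ev.hom_mult)
    moreover have t0: "eval ?t c = \<zero>" using c by (simp add: r_neg)
    moreover have "eval r c = \<zero>"
    proof -
      have "eval r c = eval ?t c [^] (?q - 1)"
        unfolding r_def using t by (rule ev.hom_nat_pow)
      then show ?thesis using q unfolding t0 by (intro nat_pow_zero[THEN trans[rotated]]) auto
    qed
    ultimately have "\<ominus> \<one> = \<zero>"
      using r s(1) ev.hom_closed[OF s(1)] ev.hom_one by (simp add: a_minus_def del: ev.hom_closed)
    then show False by (metis add.inv_eq_1_iff one_closed one_not_zero)
  qed
qed

lemma (in algebraically_closed) card_frobenius_fixed:
  fixes p n :: nat
  assumes p: "Factorial_Ring.prime p" and char: "[p] \<cdot> \<one> = \<zero>" and n: "n \<ge> 1"
  shows "finite {c \<in> carrier L. c [^] (p ^ n) = c}"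
    and "card {c \<in> carrier L. c [^] (p ^ n) = c} = p ^ n"
proof -
  define P where "P = X [^]\<^bsub>poly_ring L\<^esub> (p ^ n) \<ominus>\<^bsub>poly_ring L\<^esub> X"
  note P = simple_root_frobenius[OF p char n, folded P_def]
  have "P \<noteq> []" using P(2) p by (auto simp: prime_gt_0_nat)
  then have root: "x \<in># roots P \<longleftrightarrow> x \<in> carrier L \<and> x [^] (p ^ n) = x" for x
    unfolding roots_mem_iff_is_root[OF P(1)] is_root_def
    using \<open>P \<noteq> []\<close> P(3)[of x] by (metis nat_pow_closed r_right_minus_eq)
  then have set: "{c \<in> carrier L. c [^] (p ^ n) = c} = set_mset (roots P)"
    by auto
  then show "finite {c \<in> carrier L. c [^] (p ^ n) = c}" by simp
  have "count (roots P) c = 1" if "c \<in># roots P" for c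
  proof -
    have "count (roots P) c \<le> 1"
      using that P(4)[of c] root unfolding alg_mult_eq_count_roots[OF P(1), symmetric] by auto
    then show ?thesis using that by (metis Suc_leI One_nat_def count_greater_zero_iff le_antisym)
  qed
  then have "size (roots P) = card (set_mset (roots P))"
    unfolding size_multiset_overloaded_eq by simp
  moreover have "size (roots P) = p ^ n"
    using roots_over_carrier[OF P(1)] P(2) unfolding splitted_def by simp
  ultimately show "card {c \<in> carrier L. c [^] (p ^ n) = c} = p ^ n"
    using set by simp
qed

lemma (in field) subfield_frobenius_fixed:
  fixes p n :: nat
  assumes p: "Factorial_Ring.prime p" and char: "[p] \<cdot> \<one> = \<zero>"
  shows "subfield {c \<in> carrier R. c [^] (p ^ n) = c} R" (is "subfield ?S R")
proof (rule subfieldI')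
  have z: "\<zero> [^] (p ^ n) = \<zero>" using p by (simp add: nat_pow_zero prime_gt_0_nat)
  show "subring ?S R"
  proof (rule subringI)
    show "\<ominus> h \<in> ?S" if "h \<in> ?S" for h
    proof -
      have "\<zero> = h \<oplus> (\<ominus> h) [^] (p ^ n)"
        using that frobenius_pow_add[OF p char, of h "\<ominus> h" n] z by (simp add: r_neg)
      then show ?thesis using that by (auto intro: sum_zero_eq_neg simp: a_comm)
    qed
  qed (auto simp: frobenius_pow_add[OF p char] nat_pow_distrib)
  show "inv k \<in> ?S" if "k \<in> ?S - {\<zero>}" for k
  proof -
    have k: "k \<in> Units R" "k [^] (p ^ n) = k" using that field_Units by auto
    then have "inv k [^] (p ^ n) \<otimes> k = (inv k \<otimes> k) [^] (p ^ n)"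
      by (metis Units_closed Units_inv_closed nat_pow_distrib)
    then have "inv k [^] (p ^ n) = inv k"
      using k(1) m_comm[of k "inv k [^] (p ^ n)"] by (intro inv_unique') auto
    then show ?thesis using k(1) by simp
  qed
qed

text \<open>The field with \<open>p\<^sup>n\<close> elements is the fixed field of the \<open>n\<close>-th power of the Frobenius
  map on an algebraic closure of the prime field.\<close>

theorem exists_finite_field:
  fixes p n :: nat
  assumes p: "Factorial_Ring.prime p" and n: "n \<ge> 1"
  shows "\<exists>F :: nat ring. field F \<and> finite (carrier F) \<and> card (carrier F) = p ^ n"
proof -
  define R where "R = residue_ring (int p)"
  interpret R: residues_prime p R
    unfolding R_def using p by unfold_locales auto
  interpret R: field R by (rule R.is_field)
  let ?L = "R.alg_closure"
  interpret L: algebraic_closure ?L "R.indexed_const ` carrier R"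
    by (rule R.alg_closureE)
  have "[p] \<cdot>\<^bsub>?L\<^esub> \<one>\<^bsub>?L\<^esub> = R.indexed_const ([p] \<cdot>\<^bsub>R\<^esub> \<one>\<^bsub>R\<^esub>)"
    using ring_hom_add_pow[OF R.ring_axioms L.ring_axioms R.alg_closureE(2), of "\<one>\<^bsub>R\<^esub>" p]
      ring_hom_one[OF R.alg_closureE(2)] by simp
  also have "[p] \<cdot>\<^bsub>R\<^esub> \<one>\<^bsub>R\<^esub> = \<zero>\<^bsub>R\<^esub>"
    by (simp add: R.add_pow_one R.res_zero_eq)
  finally have char: "[p] \<cdot>\<^bsub>?L\<^esub> \<one>\<^bsub>?L\<^esub> = \<zero>\<^bsub>?L\<^esub>"
    using ring_hom_zero[OF R.alg_closureE(2) R.ring_axioms L.ring_axioms] by simp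
  let ?S = "{c \<in> carrier ?L. c [^]\<^bsub>?L\<^esub> (p ^ n) = c}"
  let ?F = "?L\<lparr>carrier := ?S\<rparr>"
  interpret F: field ?F
    by (rule L.subfield_iff(2)[OF L.subfield_frobenius_fixed[OF p char]])
  have fin: "finite (carrier ?F)" "card (carrier ?F) = p ^ n"
    using L.card_frobenius_fixed[OF p char n] by simp_all
  obtain F :: "nat ring" where F: "ring F" "finite (carrier F)" "?F \<simeq> F"
    by (rule finite_ring_iso_nat_ring[OF F.ring_axioms fin(1)])
  then show ?thesis
    using ring_iso_field[OF F.field_axioms F(1,3)] fin(2) ring_iso_same_card[OF F(3)] by auto
qed

section \<open>Uniqueness of finite fields\<close>

lemma field_hom_inj:
  assumes "field R" "field S" "h \<in> ring_hom R S"
  shows "inj_on h (carrier R)"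
proof -
  interpret R: field R by fact
  interpret S: field S by fact
  interpret h: ring_hom_ring R S h
    by (intro ring_hom_ringI2 R.ring_axioms S.ring_axioms assms(3))
  have "h \<one>\<^bsub>R\<^esub> \<noteq> \<zero>\<^bsub>S\<^esub>" by simp
  then show ?thesis
    by (intro h.non_trivial_field_hom_imp_inj assms(1)) (metis R.one_closed image_eqI singletonD)
qed

lemma carrier_UP: "carrier (UP R) = up R"
  by (simp add: UP_def)

lemma coeff_UP: "f \<in> up R \<Longrightarrow> coeff (UP R) f = f"
  by (simp add: UP_def)

lemma zero_UP: "\<zero>\<^bsub>UP R\<^esub> = (\<lambda>i. \<zero>\<^bsub>R\<^esub>)"
  by (simp add: UP_def)

text \<open>A nonzero polynomial over \<open>k\<close> has at most as many roots in an extension \<open>F\<close> as its degree;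
  the extension is given by a homomorphism \<open>psi\<close>, and applying it to the coefficients reduces the
  claim to polynomials over \<open>F\<close>.\<close>

lemma card_eval_roots_le_deg:
  assumes "field k" "field F" "finite (carrier F)" and psi: "psi \<in> ring_hom k F"
    and f: "f \<in> carrier (UP k)" "f \<noteq> \<zero>\<^bsub>UP k\<^esub>"
  shows "card {b \<in> carrier F. eval k F psi b f = \<zero>\<^bsub>F\<^esub>} \<le> deg k f"
proof -
  interpret k: field k by fact
  interpret F: field F by fact
  interpret Pk: UP_domain k "UP k" by unfold_locales
  interpret PF: UP_domain F "UP F" by unfold_locales
  interpret psi: ring_hom_ring k F psi
    by (intro ring_hom_ringI2 k.ring_axioms F.ring_axioms psi)
  have psi0: "psi x = \<zero>\<^bsub>F\<^esub> \<longleftrightarrow> x = \<zero>\<^bsub>k\<^esub>" if "x \<in> carrier k" for x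
    using field_hom_inj[OF assms(1,2) psi] that
    by (metis inj_onD k.zero_closed psi.hom_zero)
  have fup: "f \<in> up k" using f(1) by (simp only: carrier_UP)
  then have fc: "f i \<in> carrier k" for i by auto
  obtain n where n: "bound \<zero>\<^bsub>k\<^esub> n f" using fup unfolding up_def by auto
  define g where "g = psi \<circ> f"
  have gup: "g \<in> up F"
  proof (rule mem_upI)
    show "g i \<in> carrier F" for i using fc by (simp add: g_def)
    have "bound \<zero>\<^bsub>F\<^esub> n g" using n unfolding bound_def g_def by simp
    then show "\<exists>n. bound \<zero>\<^bsub>F\<^esub> n g" ..
  qed
  then have g: "g \<in> carrier (UP F)" by (simp only: carrier_UP)
  have co: "coeff (UP k) f = f" "coeff (UP F) g = g"
    by (rule coeff_UP[OF fup], rule coeff_UP[OF gup])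
  have deg: "deg F g = deg k f"
    unfolding deg_def co bound_def by (simp add: g_def psi0 fc)
  have ev: "eval F F id b g = eval k F psi b f" for b
    unfolding PF.eval_on_carrier[OF g] Pk.eval_on_carrier[OF f(1)] co deg by (simp add: g_def)
  have "g \<noteq> \<zero>\<^bsub>UP F\<^esub>"
  proof
    assume "g = \<zero>\<^bsub>UP F\<^esub>"
    then have "g i = \<zero>\<^bsub>F\<^esub>" for i by (simp only: zero_UP)
    then have "f i = \<zero>\<^bsub>k\<^esub>" for i using psi0[OF fc] by (simp add: g_def)
    then have "f = \<zero>\<^bsub>UP k\<^esub>" by (auto simp only: zero_UP)
    then show False using f(2) by simp
  qed
  then have "card {b \<in> carrier F. eval F F id b g = \<zero>\<^bsub>F\<^esub>} \<le> deg F g"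
    using PF.roots_bound[OF g _ assms(3)] by blast
  then show ?thesis by (simp add: ev deg)
qed

lemma (in domain) nat_pow_nonzero:
  "x \<in> carrier R \<Longrightarrow> x \<noteq> \<zero> \<Longrightarrow> x [^] (n::nat) \<noteq> \<zero>"
  by (induction n) (auto simp: integral_iff)

lemma (in field) pow_card_eq:
  assumes fin: "finite (carrier R)" and x: "x \<in> carrier R"
  shows "x [^] card (carrier R) = x"
proof (cases "x = \<zero>")
  case True
  have "card (carrier R) \<noteq> 0" using fin x by (auto simp: card_eq_0_iff)
  then show ?thesis unfolding True by (rule nat_pow_zero)
next
  case False
  then have "x [^] (card (carrier R) - 1) = \<one>"
    using x units_power_order_eq_one[of x] fin field_Units by (simp add: card_Diff_singleton finite_subset)
  moreover have "card (carrier R) > 0" using fin x by (auto simp: card_gt_0_iff)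
  ultimately show ?thesis using x
    by (metis One_nat_def Suc_pred l_one nat_pow_Suc)
qed

text \<open>A homomorphism \<open>B\<close> factors through a surjective \<open>A\<close> as soon as it kills the kernel of \<open>A\<close>;
  the induced map between fields of equal finite cardinality is bijective.\<close>

lemma field_iso_of_kernel_le:
  assumes "field K" "field F" and fin: "finite (carrier F)"
    and card: "card (carrier K) = card (carrier F)"
    and "ring P" and A: "A \<in> ring_hom P K" and surj: "\<And>x. x \<in> carrier K \<Longrightarrow> \<exists>g\<in>carrier P. A g = x"
    and B: "B \<in> ring_hom P F"
    and ker: "\<And>h. h \<in> carrier P \<Longrightarrow> A h = \<zero>\<^bsub>K\<^esub> \<Longrightarrow> B h = \<zero>\<^bsub>F\<^esub>"
  shows "K \<simeq> F"
proof -
  interpret K: field K by fact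
  interpret F: field F by fact
  interpret P: ring P by fact
  interpret A: ring_hom_ring P K A by (intro ring_hom_ringI2 A P.ring_axioms K.ring_axioms)
  interpret B: ring_hom_ring P F B by (intro ring_hom_ringI2 B P.ring_axioms F.ring_axioms)
  have eqB: "B g = B h" if gh: "g \<in> carrier P" "h \<in> carrier P" "A g = A h" for g h
  proof -
    have "A (g \<ominus>\<^bsub>P\<^esub> h) = \<zero>\<^bsub>K\<^esub>"
      using gh by (simp add: a_minus_def K.r_neg)
    then have "B (g \<ominus>\<^bsub>P\<^esub> h) = \<zero>\<^bsub>F\<^esub>" using ker gh by auto
    then show ?thesis using gh by (simp add: a_minus_def[of P] a_minus_def[of F, symmetric])
  qed
  define lift where "lift x = (SOME g. g \<in> carrier P \<and> A g = x)" for x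
  have lift: "lift x \<in> carrier P" "A (lift x) = x" if "x \<in> carrier K" for x
    unfolding lift_def using someI_ex[of "\<lambda>g. g \<in> carrier P \<and> A g = x"] surj[OF that] by auto
  let ?h = "\<lambda>x. B (lift x)"
  have hom: "?h \<in> ring_hom K F"
  proof (rule ring_hom_memI)
    show "?h (x \<otimes>\<^bsub>K\<^esub> y) = ?h x \<otimes>\<^bsub>F\<^esub> ?h y" if "x \<in> carrier K" "y \<in> carrier K" for x y
      using that eqB[of "lift (x \<otimes>\<^bsub>K\<^esub> y)" "lift x \<otimes>\<^bsub>P\<^esub> lift y"] by (simp add: lift)
    show "?h (x \<oplus>\<^bsub>K\<^esub> y) = ?h x \<oplus>\<^bsub>F\<^esub> ?h y" if "x \<in> carrier K" "y \<in> carrier K" for x y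
      using that eqB[of "lift (x \<oplus>\<^bsub>K\<^esub> y)" "lift x \<oplus>\<^bsub>P\<^esub> lift y"] by (simp add: lift)
    show "?h \<one>\<^bsub>K\<^esub> = \<one>\<^bsub>F\<^esub>"
      using eqB[of "lift \<one>\<^bsub>K\<^esub>" "\<one>\<^bsub>P\<^esub>"] by (simp add: lift)
  qed (simp add: lift)
  have inj: "inj_on ?h (carrier K)" by (rule field_hom_inj[OF assms(1,2) hom])
  moreover have "?h ` carrier K = carrier F"
    using card_image[OF inj] card fin ring_hom_closed[OF hom] by (intro card_subset_eq) auto
  ultimately show ?thesis
    unfolding is_ring_iso_def ring_iso_def bij_betw_def using hom by auto
qed

text \<open>Let \<open>a\<close> generate the multiplicative group of \<open>K\<close>, and let \<open>f\<close> be a polynomial over \<open>k\<close>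
  of least degree that vanishes at \<open>a\<close>. Up to a unit, \<open>X\<^sup>q - X = f u\<close>. Every one of
  the \<open>q\<close> elements of \<open>F\<close> is a root of \<open>f u\<close>, and \<open>u\<close> has fewer than \<open>q\<close> roots,
  so \<open>f\<close> has a root \<open>b\<close> in \<open>F\<close>. Evaluation at \<open>b\<close> then kills the kernel of
  evaluation at \<open>a\<close>.\<close>

theorem finite_fields_iso_over:
  assumes "field k" "field K" "field F" and fin: "finite (carrier K)" "finite (carrier F)"
    and card: "card (carrier K) = card (carrier F)"
    and phi: "phi \<in> ring_hom k K" and psi: "psi \<in> ring_hom k F"
  shows "K \<simeq> F"
proof -
  interpret k: field k by fact
  interpret K: field K by fact
  interpret F: field F by fact
  obtain a where a: "a \<in> carrier (Multiplicative_Group.mult_of K)"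
    and gen: "carrier (Multiplicative_Group.mult_of K) = {a [^]\<^bsub>K\<^esub> i | i::nat. i \<in> UNIV}"
    by (rule bexE[OF K.finite_field_mult_group_has_gen[OF fin(1)]])
  have gen: "\<exists>i::nat. x = a [^]\<^bsub>K\<^esub> i" if "x \<in> carrier K" "x \<noteq> \<zero>\<^bsub>K\<^esub>" for x
    using gen that by auto
  let ?P = "UP k"
  interpret P: UP_domain k ?P by unfold_locales
  interpret phi: UP_pre_univ_prop k K phi ?P
    by (intro UP_pre_univ_propI k.is_cring K.is_cring phi)
  interpret psi: UP_pre_univ_prop k F psi ?P
    by (intro UP_pre_univ_propI k.is_cring F.is_cring psi)
  define q where "q = card (carrier K)"
  have q: "q \<ge> 2"
    using card_mono[OF fin(1), of "{\<zero>\<^bsub>K\<^esub>, \<one>\<^bsub>K\<^esub>}"] by (simp add: q_def)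
  have a: "a \<in> carrier K" using a by simp
  define A where "A = eval k K phi a"
  define B where "B = (\<lambda>b. eval k F psi b)"
  interpret A: ring_hom_cring ?P K A
    unfolding A_def by (intro ring_hom_cringI P.P.is_cring K.is_cring phi.eval_ring_hom a)
  have B: "ring_hom_cring ?P F (B b)" if "b \<in> carrier F" for b
    unfolding B_def by (intro ring_hom_cringI P.P.is_cring F.is_cring psi.eval_ring_hom that)
  have surj: "\<exists>f \<in> carrier ?P. A f = x" if "x \<in> carrier K" for x
  proof (cases "x = \<zero>\<^bsub>K\<^esub>")
    case False
    from gen[OF that False] obtain i :: nat where i: "x = a [^]\<^bsub>K\<^esub> i" ..
    have "A (monom ?P \<one>\<^bsub>k\<^esub> i) = x"
      unfolding A_def i using a by (simp add: phi.eval_monom)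
    then show ?thesis using P.monom_closed[OF k.one_closed] by (rule bexI)
  next
    case True
    then show ?thesis using A.hom_zero P.UP_zero_closed by (intro bexI[of _ "\<zero>\<^bsub>?P\<^esub>"]) simp_all
  qed
  define g0 where "g0 = monom ?P \<one>\<^bsub>k\<^esub> q \<ominus>\<^bsub>?P\<^esub> monom ?P \<one>\<^bsub>k\<^esub> 1"
  have g0: "g0 \<in> carrier ?P" by (simp add: g0_def)
  have deg0: "deg k g0 = q"
  proof (rule le_antisym)
    show "deg k g0 \<le> q"
      using q by (intro P.deg_aboveI g0) (simp add: g0_def)
    show "q \<le> deg k g0"
      using q by (intro P.deg_belowI g0) (simp add: g0_def)
  qed
  have g0nz: "g0 \<noteq> \<zero>\<^bsub>?P\<^esub>" using deg0 q P.deg_zero by force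
  have A0: "A g0 = \<zero>\<^bsub>K\<^esub>"
    using a K.pow_card_eq[OF fin(1) a] phi.eval_monom[OF k.one_closed a]
    by (simp add: g0_def a_minus_def A_def[symmetric] q_def K.r_neg)
  have B0: "B b g0 = \<zero>\<^bsub>F\<^esub>" if b: "b \<in> carrier F" for b
  proof -
    interpret B: ring_hom_cring ?P F "B b" by (rule B[OF b])
    show ?thesis
      using b F.pow_card_eq[OF fin(2) b] psi.eval_monom[OF k.one_closed b]
      by (simp add: g0_def a_minus_def B_def[symmetric] q_def F.r_neg card)
  qed
  define Q where "Q h \<longleftrightarrow> h \<in> carrier ?P \<and> h \<noteq> \<zero>\<^bsub>?P\<^esub> \<and> A h = \<zero>\<^bsub>K\<^esub>" for h
  have "Q g0" unfolding Q_def by (intro conjI g0 g0nz A0)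
  then obtain f where Qf: "Q f" and least: "\<forall>h. Q h \<longrightarrow> deg k f \<le> deg k h"
    using ex_has_least_nat[of Q g0 "deg k"] by metis
  have f: "f \<in> carrier ?P" "f \<noteq> \<zero>\<^bsub>?P\<^esub>" "A f = \<zero>\<^bsub>K\<^esub>"
    using Qf unfolding Q_def by simp_all
  have min: "deg k f \<le> deg k h" if "h \<in> carrier ?P" "h \<noteq> \<zero>\<^bsub>?P\<^esub>" "A h = \<zero>\<^bsub>K\<^esub>" for h
    using least that unfolding Q_def by simp
  have dvd: "\<exists>c u. c \<in> carrier k \<and> c \<noteq> \<zero>\<^bsub>k\<^esub> \<and> u \<in> carrier ?P \<and> c \<odot>\<^bsub>?P\<^esub> h = f \<otimes>\<^bsub>?P\<^esub> u"
    if h: "h \<in> carrier ?P" "A h = \<zero>\<^bsub>K\<^esub>" for h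
  proof -
    obtain u r and n :: nat where u: "u \<in> carrier ?P" and r: "r \<in> carrier ?P"
      and eq: "coeff ?P f (deg k f) [^]\<^bsub>k\<^esub> n \<odot>\<^bsub>?P\<^esub> h = f \<otimes>\<^bsub>?P\<^esub> u \<oplus>\<^bsub>?P\<^esub> r"
      and small: "r = \<zero>\<^bsub>?P\<^esub> \<or> deg k r < deg k f"
      using P.long_div_theorem[OF f(1) h(1) f(2)] by (elim exE conjE)
    let ?c = "coeff ?P f (deg k f) [^]\<^bsub>k\<^esub> n"
    have c: "?c \<in> carrier k" "?c \<noteq> \<zero>\<^bsub>k\<^esub>"
      using P.lcoeff_nonzero2[OF f(1,2)] k.nat_pow_nonzero P.coeff_closed[OF f(1)] by simp_all
    have "A (?c \<odot>\<^bsub>?P\<^esub> h) = A (monom ?P ?c 0) \<otimes>\<^bsub>K\<^esub> A h"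
      using c h(1) by (simp add: P.monom_mult_is_smult[symmetric] del: P.monom_mult_is_smult)
    then have "A r = \<zero>\<^bsub>K\<^esub>"
      using h c u r f eq by simp
    then have "r = \<zero>\<^bsub>?P\<^esub>" using small min[OF r] by fastforce
    then show ?thesis using c u f(1) eq
      by (intro exI[of _ ?c] exI[of _ u] conjI) simp_all
  qed
  have transfer: "B b f \<otimes>\<^bsub>F\<^esub> B b u = psi c \<otimes>\<^bsub>F\<^esub> B b h \<and> psi c \<noteq> \<zero>\<^bsub>F\<^esub> \<and> psi c \<in> carrier F"
    if "c \<in> carrier k" "c \<noteq> \<zero>\<^bsub>k\<^esub>" "u \<in> carrier ?P" "h \<in> carrier ?P"
      "c \<odot>\<^bsub>?P\<^esub> h = f \<otimes>\<^bsub>?P\<^esub> u" "b \<in> carrier F" for c u h b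
  proof -
    interpret B: ring_hom_cring ?P F "B b" by (rule B[OF that(6)])
    have "c \<odot>\<^bsub>?P\<^esub> h = monom ?P c 0 \<otimes>\<^bsub>?P\<^esub> h"
      using that by (intro P.monom_mult_is_smult[symmetric])
    then have "B b (c \<odot>\<^bsub>?P\<^esub> h) = B b (monom ?P c 0) \<otimes>\<^bsub>F\<^esub> B b h"
      using that B.hom_mult P.monom_closed by metis
    moreover have "B b (monom ?P c 0) = psi c"
      unfolding B_def using that by (simp add: psi.eval_const)
    moreover have "psi c \<noteq> \<zero>\<^bsub>F\<^esub>"
      using field_hom_inj[OF assms(1,3) psi] that(1,2)
      by (metis inj_onD k.zero_closed psi.hom_zero)
    ultimately show ?thesis using that f(1) by simp
  qed
  obtain c u where cu: "c \<in> carrier k" "c \<noteq> \<zero>\<^bsub>k\<^esub>" "u \<in> carrier ?P"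
    "c \<odot>\<^bsub>?P\<^esub> g0 = f \<otimes>\<^bsub>?P\<^esub> u"
    using dvd[OF g0 A0] by (elim exE conjE)
  have deg_prod: "deg k (c \<odot>\<^bsub>?P\<^esub> g0) = q"
    using P.deg_smult[OF cu(1) g0] cu(2) deg0 by simp
  have unz: "u \<noteq> \<zero>\<^bsub>?P\<^esub>"
    using deg_prod cu(4) f(1) q by (intro notI) simp
  have degs: "deg k f + deg k u = q"
    using P.deg_mult[OF f(2) unz f(1) cu(3)] deg_prod cu(4) by simp
  have degf: "deg k f > 0"
  proof (rule ccontr)
    assume "\<not> deg k f > 0"
    then have "f = monom ?P (coeff ?P f 0) 0" using P.deg_zero_impl_monom[OF f(1)] by simp
    then have "A f = phi (coeff ?P f 0)"
      unfolding A_def using phi.eval_const[OF a] f(1) by (metis P.coeff_closed)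
    moreover have "coeff ?P f 0 \<noteq> \<zero>\<^bsub>k\<^esub>"
      using P.lcoeff_nonzero2[OF f(1,2)] \<open>\<not> deg k f > 0\<close> by simp
    ultimately show False
      using f(3) field_hom_inj[OF assms(1,2) phi] f(1)
      by (metis P.coeff_closed inj_onD k.zero_closed phi.hom_zero)
  qed
  have "\<exists>b \<in> carrier F. B b f = \<zero>\<^bsub>F\<^esub>"
  proof (rule ccontr)
    assume no: "\<not> ?thesis"
    have "B b u = \<zero>\<^bsub>F\<^esub>" if b: "b \<in> carrier F" for b
    proof -
      interpret B: ring_hom_cring ?P F "B b" by (rule B[OF b])
      have "B b f \<otimes>\<^bsub>F\<^esub> B b u = \<zero>\<^bsub>F\<^esub>"
        using transfer[OF cu(1-3) g0 cu(4) b] B0[OF b] by simp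
      then show ?thesis
        using no b F.integral_iff[of "B b f" "B b u"] f(1) cu(3) by (meson B.hom_closed)
    qed
    then have "{b \<in> carrier F. eval k F psi b u = \<zero>\<^bsub>F\<^esub>} = carrier F"
      by (subst set_eq_iff) (simp add: B_def[symmetric] cong: conj_cong)
    then have "q \<le> deg k u"
      using card_eval_roots_le_deg[OF assms(1,3) fin(2) psi cu(3) unz] by (simp add: q_def card)
    then show False using degs degf by simp
  qed
  then obtain b where b: "b \<in> carrier F" "B b f = \<zero>\<^bsub>F\<^esub>" ..
  interpret B: ring_hom_cring ?P F "B b" by (rule B[OF b(1)])
  have ker: "B b h = \<zero>\<^bsub>F\<^esub>" if h: "h \<in> carrier ?P" "A h = \<zero>\<^bsub>K\<^esub>" for h
  proof -
    obtain c u where cu: "c \<in> carrier k" "c \<noteq> \<zero>\<^bsub>k\<^esub>" "u \<in> carrier ?P"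
      "c \<odot>\<^bsub>?P\<^esub> h = f \<otimes>\<^bsub>?P\<^esub> u"
      using dvd[OF h] by (elim exE conjE)
    then show ?thesis
      using transfer[OF cu(1-3) h(1) cu(4) b(1)] F.integral_iff[of "psi c" "B b h"]
        B.hom_closed[OF h(1)] B.hom_closed[OF cu(3)] by (simp only: b(2) F.l_null) metis
  qed
  show ?thesis
    by (rule field_iso_of_kernel_le[OF assms(2,3) fin(2) card P.UP_ring A.homh surj B.homh ker])
qed

lemma (in cring) char_hom_residue_ring:
  assumes p: "Factorial_Ring.prime (p::nat)" and char: "[p] \<cdot> \<one> = \<zero>"
  shows "(\<lambda>z::int. [z] \<cdot> \<one>) \<in> ring_hom (residue_ring (int p)) R"
proof -
  have mod: "[(z mod int p)] \<cdot> \<one> = [z] \<cdot> \<one>" for z :: int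
  proof -
    have "[(int p)] \<cdot> \<one> = \<zero>" using char by (simp add: add_pow_int_ge)
    then have "[(int p * (z div int p))] \<cdot> \<one> = \<zero>"
      by (metis add.int_pow_one add.int_pow_pow one_closed)
    then show ?thesis
      using add.int_pow_mult[of \<one> "int p * (z div int p)" "z mod int p"] by simp
  qed
  show ?thesis
  proof (rule ring_hom_memI)
    show "[(x \<otimes>\<^bsub>residue_ring (int p)\<^esub> y)] \<cdot> \<one> = [x] \<cdot> \<one> \<otimes> [y] \<cdot> \<one>" for x y :: int
      by (simp add: residue_ring_def mod add_pow_ldistr_int add.int_pow_pow mult.commute)
    show "[(x \<oplus>\<^bsub>residue_ring (int p)\<^esub> y)] \<cdot> \<one> = [x] \<cdot> \<one> \<oplus> [y] \<cdot> \<one>" for x y :: int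
      by (simp add: residue_ring_def mod add.int_pow_mult)
  qed (simp_all add: residue_ring_def add_pow_int_ge)
qed

lemma (in cring) add_pow_one_power: "[((p::nat) ^ n)] \<cdot> \<one> = ([p] \<cdot> \<one>) [^] n"
proof (induction n)
  case (Suc n)
  have "[(p ^ Suc n)] \<cdot> \<one> = [p] \<cdot> ([(p ^ n)] \<cdot> \<one>)"
    using add.nat_pow_pow[of \<one> p "p ^ n"] by (simp add: mult.commute)
  then show ?case by (simp add: Suc.IH add_pow_rdistr)
qed simp

lemma (in field) char_of_card:
  fixes p n :: nat
  assumes "card (carrier R) = p ^ n" and p: "p > 0"
  shows "[p] \<cdot> \<one> = \<zero>"
proof -
  have fin: "finite (carrier R)" using assms by (intro card_ge_0_finite) simp
  have "[(p ^ n)] \<cdot> \<one> = \<zero>"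
    using add.pow_order_eq_1[of \<one>] fin assms by (simp add: order_def)
  then show ?thesis unfolding add_pow_one_power using nat_pow_nonzero[of "[p] \<cdot> \<one>" n] by auto
qed

theorem finite_fields_iso:
  fixes p n :: nat
  assumes p: "Factorial_Ring.prime p" and K: "field K" "card (carrier K) = p ^ n"
    and F: "field F" "card (carrier F) = p ^ n"
  shows "K \<simeq> F"
proof -
  interpret K: field K by fact
  interpret F: field F by fact
  interpret R: residues_prime p "residue_ring (int p)"
    using p by unfold_locales auto
  have p0: "p > 0" using p by (simp add: prime_gt_0_nat)
  show ?thesis
  proof (rule finite_fields_iso_over[OF R.is_field K(1) F(1)])
    show "finite (carrier K)" "finite (carrier F)"
      using K(2) F(2) p0 by (auto intro: card_ge_0_finite)
  qed (use K F K.char_hom_residue_ring[OF p K.char_of_card[OF K(2) p0]]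
         F.char_hom_residue_ring[OF p F.char_of_card[OF F(2) p0]] in auto)
qed

lemma GF_field:
  fixes p n :: nat
  assumes "Factorial_Ring.prime p" "n \<ge> 1"
  shows "field (GF (p ^ n))" "finite (carrier (GF (p ^ n)))" "card (carrier (GF (p ^ n))) = p ^ n"
  unfolding GF_def using someI_ex[OF exists_finite_field[OF assms]] by auto

section \<open>Prime power orders\<close>

lemma dvd_power_diff_one_imp_dvd:
  fixes p l s :: nat
  assumes "p \<ge> 2" "(p ^ l - 1) dvd (p ^ s - 1)" "l \<ge> 1"
  shows "l dvd s"
  using assms(2)
proof (induction s rule: less_induct)
  case (less s)
  show ?case
  proof (cases "s < l")
    case True
    then have "p ^ s < p ^ l" using assms(1) by (intro power_strict_increasing) auto
    moreover have "p ^ s > 0" using assms(1) by simp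
    ultimately have "p ^ s - 1 < p ^ l - 1" by (intro diff_less_mono) linarith+
    then have "p ^ s - 1 = 0" using less.prems nat_dvd_not_less by blast
    then have "p ^ s = 1" using \<open>p ^ s > 0\<close> by linarith
    then have "s = 0" using assms(1) by simp
    then show ?thesis by simp
  next
    case False
    then have "p ^ s = p ^ (s - l) * p ^ l" by (simp flip: power_add)
    moreover have "p ^ l \<ge> 1" "p ^ (s - l) \<ge> 1" using assms(1) by simp_all
    ultimately have "p ^ s - 1 = p ^ (s - l) * (p ^ l - 1) + (p ^ (s - l) - 1)"
      by (simp add: diff_mult_distrib2)
    then have "(p ^ l - 1) dvd (p ^ (s - l) - 1)"
      using less.prems by (metis dvd_add_right_iff dvd_triv_right)
    then have "l dvd (s - l)" using less.IH[of "s - l"] False assms(3) by simp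
    then show ?thesis using False by (metis dvd_diffD dvd_refl leI)
  qed
qed

text \<open>If another prime \<open>r\<close> divided the order, a subgroup of order \<open>r\<close> would contain an element
  whose order divides both \<open>r\<close> and a power of \<open>p\<close>.\<close>

lemma (in group) order_prime_power:
  fixes p n :: nat
  assumes p: "Factorial_Ring.prime p" and fin: "finite (carrier G)"
    and tors: "\<And>x. x \<in> carrier G \<Longrightarrow> x [^] (p ^ n) = \<one>"
  shows "\<exists>a. order G = p ^ a"
proof -
  have "order G \<noteq> 0" using fin order_gt_0_iff_finite by simp
  then obtain m where m: "order G = p ^ multiplicity p (order G) * m" "\<not> p dvd m"
    using multiplicity_decompose'[of "order G" p] p by (metis not_prime_unit)
  have "m = 1"
  proof (rule ccontr)
    assume "m \<noteq> 1"
    then obtain r where r: "Factorial_Ring.prime r" "r dvd m" using prime_factor_nat by blast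
    have "r dvd order G" using r(2) m(1) by (metis dvd_mult)
    then obtain c where "order G = r ^ 1 * c" by auto
    then obtain H where H: "subgroup H G" "card H = r ^ 1"
      using sylow_thm[OF r(1) is_group _ fin] by blast
    interpret H: group "G\<lparr>carrier := H\<rparr>" by (rule subgroup.subgroup_is_group[OF H(1) is_group])
    have "H \<noteq> {\<one>}" using H(2) prime_gt_1_nat[OF r(1)] by auto
    then obtain x where x: "x \<in> H" "x \<noteq> \<one>" using subgroup.one_closed[OF H(1)] by auto
    have xG: "x \<in> carrier G" using x(1) subgroup.subset[OF H(1)] by auto
    have "x [^]\<^bsub>G\<lparr>carrier := H\<rparr>\<^esub> order (G\<lparr>carrier := H\<rparr>) = \<one>"
      using H.pow_order_eq_1[of x] x(1) by simp
    then have "x [^] r = \<one>"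
      using H(2) nat_pow_consistent[of x r H] by (simp add: order_def)
    then have "ord x dvd r" using pow_eq_id[OF xG] by simp
    moreover have "ord x dvd p ^ n" using pow_eq_id[OF xG] tors[OF xG] by simp
    moreover have "coprime r (p ^ n)"
      using r m(2) p by (metis coprime_power_right_iff primes_coprime)
    ultimately have "ord x = 1" by (metis coprime_common_divisor nat_dvd_1_iff_1)
    then show False using ord_eq_1[OF xG] x(2) by simp
  qed
  then show ?thesis using m(1) by auto
qed

section \<open>Finite local rings\<close>

text \<open>A finite local ring \<open>R\<close> with maximal ideal \<open>\<mm>\<close>.\<close>

locale finite_local = cring R + maximalideal \<mm> R for R (structure) and \<mm> +
  assumes unique_maximal: "maximalideal M R \<Longrightarrow> M = \<mm>"
    and finite_carrier: "finite (carrier R)"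

lemma finite_localI: "local_ring A \<mm> \<Longrightarrow> finite (carrier A) \<Longrightarrow> finite_local A \<mm>"
  unfolding local_ring_def finite_local_def finite_local_axioms_def by auto

context finite_local
begin

lemma one_not_mem: "\<one> \<notin> \<mm>"
  using one_imp_carrier I_notcarr by auto

lemma nonunit_mem:
  assumes x: "x \<in> carrier R" "x \<notin> Units R"
  shows "x \<in> \<mm>"
proof -
  define S where "S = {J. ideal J R \<and> x \<in> J \<and> J \<noteq> carrier R}"
  have "S \<subseteq> Pow (carrier R)"
    unfolding S_def by (auto intro: ideal.Icarr)
  then have fin: "finite S"
    by (rule finite_subset) (simp add: finite_carrier)
  have "PIdl x \<noteq> carrier R"
  proof
    assume "PIdl x = carrier R"
    then have "\<one> \<in> PIdl x" by simp
    then obtain y where y: "y \<in> carrier R" "\<one> = y \<otimes> x" unfolding cgenideal_def by auto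
    then have "x \<otimes> y = \<one>" using x(1) m_comm[of x y] by simp
    then have "x \<in> Units R" unfolding Units_def using x(1) y by auto
    then show False using x(2) by simp
  qed
  then have "PIdl x \<in> S" using x by (simp add: S_def cgenideal_ideal cgenideal_self)
  then have "S \<noteq> {}" by auto
  from finite_has_maximal[OF fin this] obtain M
    where M: "M \<in> S" and max: "\<forall>J\<in>S. M \<subseteq> J \<longrightarrow> M = J" ..
  have "maximalideal M R"
  proof (rule maximalidealI)
    fix J assume J: "ideal J R" "M \<subseteq> J" "J \<subseteq> carrier R"
    then show "J = M \<or> J = carrier R" using M max unfolding S_def by blast
  qed (use M in \<open>auto simp: S_def\<close>)
  from unique_maximal[OF this] show ?thesis using M by (simp add: S_def)
qed

lemma Units_eq: "Units R = carrier R - \<mm>"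
proof -
  have "x \<notin> \<mm>" if x: "x \<in> Units R" for x
  proof
    assume "x \<in> \<mm>"
    then have "inv x \<otimes> x \<in> \<mm>" using x by (intro I_l_closed) auto
    then show False using x one_not_mem by simp
  qed
  then show ?thesis using nonunit_mem by auto
qed

lemma one_plus_Units: "x \<in> \<mm> \<Longrightarrow> \<one> \<oplus> x \<in> Units R"
proof -
  assume x: "x \<in> \<mm>"
  have "\<one> \<oplus> x \<notin> \<mm>"
  proof
    assume "\<one> \<oplus> x \<in> \<mm>"
    then have "(\<one> \<oplus> x) \<oplus> \<ominus> x \<in> \<mm>" 
      using x additive_subgroup.a_closed[OF is_additive_subgroup] by simp
    moreover have "(\<one> \<oplus> x) \<oplus> \<ominus> x = \<one>" using x by (simp add: a_assoc r_neg)
    ultimately show False using one_not_mem by simp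
  qed
  then show ?thesis using x by (simp add: Units_eq)
qed

text \<open>Two powers of \<open>x\<close> coincide, say \<open>x\<^sup>i = x\<^sup>j\<close> with \<open>i < j\<close>; then \<open>x\<^sup>i\<close> is annihilated
  by one minus a positive power of \<open>x\<close>, which is a unit.\<close>

lemma mem_nilpotent:
  assumes x: "x \<in> \<mm>"
  shows "\<exists>n::nat. x [^] n = \<zero>"
proof -
  have "\<not> inj (\<lambda>n::nat. x [^] n)"
  proof
    assume "inj (\<lambda>n::nat. x [^] n)"
    moreover have "range (\<lambda>n::nat. x [^] n) \<subseteq> carrier R" using x by auto
    ultimately show False
      using finite_carrier by (meson finite_imageD finite_subset infinite_UNIV_nat)
  qed
  then obtain i j :: nat where ij: "i < j" "x [^] i = x [^] j"
    unfolding inj_def by (metis nat_neq_iff)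
  have xc: "x \<in> carrier R" using x by simp
  define d where "d = j - i - 1"
  have "x [^] Suc d \<in> \<mm>" using x by (simp add: I_l_closed)
  then have u: "\<one> \<oplus> \<ominus> (x [^] Suc d) \<in> Units R" by (intro one_plus_Units a_inv_closed)
  have "x [^] i \<otimes> (\<one> \<oplus> \<ominus> (x [^] Suc d)) = x [^] i \<ominus> x [^] (i + Suc d)"
    using xc by (simp add: r_distr r_minus nat_pow_mult[symmetric] a_minus_def m_assoc)
  also have "i + Suc d = j" using ij by (simp add: d_def)
  finally have "x [^] i \<otimes> (\<one> \<oplus> \<ominus> (x [^] Suc d)) = \<zero>"
    using ij(2) xc by (simp add: a_minus_def r_neg)
  then have "x [^] i \<otimes> ((\<one> \<oplus> \<ominus> (x [^] Suc d)) \<otimes> inv (\<one> \<oplus> \<ominus> (x [^] Suc d))) = \<zero>"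
    using u xc by (subst m_assoc[symmetric]) (simp_all add: Units_closed)
  then have "x [^] i = \<zero>"
    using u xc by simp
  then show ?thesis ..
qed

end

section \<open>The groups \<open>1 + I\<close>\<close>

lemma (in ring) ideal_closures:
  assumes "ideal I R"
  shows "\<zero> \<in> I" and "x \<in> I \<Longrightarrow> y \<in> I \<Longrightarrow> x \<oplus> y \<in> I" and "x \<in> I \<Longrightarrow> \<ominus> x \<in> I"
  using ideal.axioms(1)[OF assms] additive_subgroup.zero_closed additive_subgroup.a_closed
    additive_subgroup.a_inv_closed abelian_group_axioms by metis+

lemma one_plus_simps:
  "carrier (one_plus R I) = (\<lambda>x. \<one>\<^bsub>R\<^esub> \<oplus>\<^bsub>R\<^esub> x) ` I"
  "x \<otimes>\<^bsub>one_plus R I\<^esub> y = x \<otimes>\<^bsub>R\<^esub> y"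
  "\<one>\<^bsub>one_plus R I\<^esub> = \<one>\<^bsub>R\<^esub>"
  by (simp_all add: one_plus_def units_of_mult units_of_one)

context finite_local
begin

lemma one_plus_subgroup:
  assumes I: "ideal I R" and sub: "I \<subseteq> \<mm>"
  shows "subgroup (carrier (one_plus R I)) (units_of R)"
proof -
  interpret I: ideal I R by fact
  interpret U: group "units_of R" by (rule units_group)
  show ?thesis
  proof (rule U.subgroupI)
    show "carrier (one_plus R I) \<subseteq> carrier (units_of R)"
      using sub one_plus_Units by (auto simp: one_plus_simps units_of_carrier)
    show "carrier (one_plus R I) \<noteq> {}"
      unfolding one_plus_simps using ideal_closures(1)[OF I] by blast
    fix u assume "u \<in> carrier (one_plus R I)"
    then obtain x where x: "x \<in> I" "u = \<one> \<oplus> x" by (auto simp: one_plus_simps)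
    have xc: "x \<in> carrier R" using x(1) by (rule I.Icarr)
    have u: "u \<in> Units R" using x sub one_plus_Units by auto
    have "inv u = inv u \<otimes> (u \<oplus> \<ominus> x)"
      using xc u x(2) by (simp add: a_assoc r_neg)
    also have "\<dots> = \<one> \<oplus> (\<ominus> (inv u)) \<otimes> x"
      using xc u by (simp add: r_distr Units_closed l_minus r_minus)
    finally have eq: "inv u = \<one> \<oplus> (\<ominus> (inv u)) \<otimes> x" .
    have "(\<ominus> (inv u)) \<otimes> x \<in> I" using x(1) u by (intro I.I_l_closed) simp_all
    then have "inv u \<in> carrier (one_plus R I)"
      by (subst eq) (simp add: one_plus_simps)
    then show "inv\<^bsub>units_of R\<^esub> u \<in> carrier (one_plus R I)"
      using u by (simp add: units_of_inv)
    fix v assume "v \<in> carrier (one_plus R I)"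
    then obtain y where y: "y \<in> I" "v = \<one> \<oplus> y" by (auto simp: one_plus_simps)
    have yc: "y \<in> carrier R" using y(1) by (rule I.Icarr)
    have "u \<otimes> v = \<one> \<oplus> (x \<oplus> (y \<oplus> x \<otimes> y))"
      unfolding x y using xc yc by (simp add: l_distr r_distr a_ac)
    moreover have "x \<oplus> (y \<oplus> x \<otimes> y) \<in> I"
      using x y xc by (intro ideal_closures(2)[OF I] I.I_l_closed)
    ultimately show "u \<otimes>\<^bsub>units_of R\<^esub> v \<in> carrier (one_plus R I)"
      by (simp add: one_plus_simps units_of_mult)
  qed
qed

lemma one_plus_comm_group:
  assumes "ideal I R" "I \<subseteq> \<mm>"
  shows "comm_group (one_plus R I)"
proof -
  have "group (units_of R\<lparr>carrier := carrier (one_plus R I)\<rparr>)"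
    by (rule subgroup.subgroup_is_group[OF one_plus_subgroup[OF assms] units_group])
  then have "group (one_plus R I)" by (simp add: one_plus_def)
  then show ?thesis
  proof (rule group.group_comm_groupI)
    fix u v assume "u \<in> carrier (one_plus R I)" "v \<in> carrier (one_plus R I)"
    then have "u \<in> carrier R" "v \<in> carrier R"
      using subgroup.subset[OF one_plus_subgroup[OF assms]] by (auto simp: units_of_carrier)
    then show "u \<otimes>\<^bsub>one_plus R I\<^esub> v = v \<otimes>\<^bsub>one_plus R I\<^esub> u"
      by (simp add: one_plus_simps m_comm)
  qed
qed

lemma one_plus_subgroup_mono:
  assumes "ideal I R" "I \<subseteq> \<mm>" "ideal J R" "J \<subseteq> I"
  shows "subgroup (carrier (one_plus R J)) (one_plus R I)"
proof -
  interpret U: group "units_of R" by (rule units_group)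
  have "subgroup (carrier (one_plus R J)) (units_of R\<lparr>carrier := carrier (one_plus R I)\<rparr>)"
    using assms one_plus_subgroup[of I] one_plus_subgroup[of J]
    by (intro U.subgroup_incl) (auto simp: one_plus_simps)
  then show ?thesis by (simp add: one_plus_def)
qed

lemma inj_one_plus: "I \<subseteq> carrier R \<Longrightarrow> inj_on (\<lambda>x. \<one> \<oplus> x) I"
  by (intro inj_onI) (simp add: subset_iff)

lemma order_one_plus: "I \<subseteq> carrier R \<Longrightarrow> order (one_plus R I) = card I"
  by (simp add: order_def one_plus_simps card_image inj_one_plus)

text \<open>If \<open>\<mm>I \<subseteq> J \<subseteq> I\<close>, then \<open>I/J\<close> is a vector space over the residue field: the residue class of
  \<open>a\<close> sends the class of \<open>x\<close> to the class of \<open>ax\<close>, which is the product of the two cosets modulo \<open>J\<close>.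
  Scalars are taken from a field \<open>K\<close> identified with the residue field by \<open>\<tau>\<close>. The
  multiplication and unit components required by the record type play no role.\<close>

definition quotient_space :: "('c \<Rightarrow> 'a set) \<Rightarrow> 'a set \<Rightarrow> 'a set \<Rightarrow> ('c, 'a set) module"
  where "quotient_space \<tau> I J = \<lparr>carrier = (\<lambda>x. J +> x) ` I, monoid.mult = rcoset_mult R J, one = J,
    ring.zero = J, ring.add = set_add R, smult = (\<lambda>c v. rcoset_mult R J (\<tau> c) v)\<rparr>"

context
  fixes I J :: "'a set"
  assumes I: "ideal I R" and J: "ideal J R" and JI: "J \<subseteq> I" and Im: "I \<subseteq> \<mm>"
    and mI: "\<And>a x. a \<in> \<mm> \<Longrightarrow> x \<in> I \<Longrightarrow> a \<otimes> x \<in> J"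
begin

interpretation I: ideal I R by (rule I)
interpretation J: ideal J R by (rule J)

lemma scalar_mult_coset:
  assumes a: "a \<in> carrier R" and x: "x \<in> I"
  shows "rcoset_mult R J (\<mm> +> a) (J +> x) = J +> (a \<otimes> x)"
proof -
  have xc: "x \<in> carrier R" using x by (rule I.Icarr)
  have "J +> (a' \<otimes> x') = J +> (a \<otimes> x)" if a': "a' \<in> \<mm> +> a" and x': "x' \<in> J +> x" for a' x'
  proof -
    obtain h where h: "h \<in> \<mm>" "a' = h \<oplus> a" using a' by (auto simp: a_r_coset_def')
    obtain j where j: "j \<in> J" "x' = j \<oplus> x" using x' by (auto simp: a_r_coset_def')
    have hc: "h \<in> carrier R" using h(1) by (rule Icarr)
    have jc: "j \<in> carrier R" using j(1) by (rule J.Icarr)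
    have "a' \<otimes> x' = (a' \<otimes> j \<oplus> h \<otimes> x) \<oplus> a \<otimes> x"
      unfolding h j using hc jc a xc by (simp add: l_distr r_distr a_ac)
    moreover have "a' \<otimes> j \<oplus> h \<otimes> x \<in> J"
      by (rule ideal_closures(2)[OF J J.I_l_closed[OF j(1)] mI[OF h(1) x]]) (simp add: h(2) hc a)
    ultimately have "a' \<otimes> x' \<in> J +> (a \<otimes> x)"
      by (auto simp: a_r_coset_def')
    then show ?thesis
      using a xc by (intro J.a_repr_independence'[symmetric]) simp_all
  qed
  moreover have "a \<in> \<mm> +> a" "x \<in> J +> x" using a xc a_rcos_self J.a_rcos_self by auto
  ultimately show ?thesis unfolding rcoset_mult_def by blast
qed

lemma quotient_space_abelian_group: "abelian_group (quotient_space \<tau> I J)"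
proof -
  let ?V = "quotient_space \<tau> I J"
  have carrier: "carrier ?V = (\<lambda>x. J +> x) ` I" and zero: "\<zero>\<^bsub>?V\<^esub> = J +> \<zero>"
    by (simp_all add: quotient_space_def J.a_rcos_const)
  have add: "(J +> x) \<oplus>\<^bsub>?V\<^esub> (J +> y) = J +> (x \<oplus> y)" if "x \<in> I" "y \<in> I" for x y
    using that by (simp add: quotient_space_def J.a_rcos_sum)
  show ?thesis
  proof (rule abelian_groupI)
    show "\<exists>y\<in>carrier ?V. y \<oplus>\<^bsub>?V\<^esub> x = \<zero>\<^bsub>?V\<^esub>" if x: "x \<in> carrier ?V" for x
    proof -
      obtain x' where x': "x' \<in> I" "x = J +> x'" using x by (auto simp: carrier)
      then show ?thesis
        by (intro bexI[of _ "J +> (\<ominus> x')"]) (simp_all add: carrier add zero l_neg ideal_closures[OF I])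
    qed
  qed (auto simp: carrier add zero a_ac ideal_closures[OF I])
qed

lemma quotient_space_vector_space:
  assumes K: "field K" and \<tau>: "\<tau> \<in> ring_iso K (R Quot \<mm>)"
  shows "is_vector_space K (quotient_space \<tau> I J)"
proof -
  let ?V = "quotient_space \<tau> I J"
  interpret K: field K by fact
  have hom: "\<tau> \<in> ring_hom K (R Quot \<mm>)" using \<tau> by (simp add: ring_iso_def)
  have rep: "\<exists>a\<in>carrier R. \<tau> c = \<mm> +> a" if "c \<in> carrier K" for c
    using ring_hom_closed[OF hom that] by (auto simp: FactRing_def A_RCOSETS_def')
  have carrier: "carrier ?V = (\<lambda>x. J +> x) ` I" and zero: "\<zero>\<^bsub>?V\<^esub> = J +> \<zero>"
    by (simp_all add: quotient_space_def J.a_rcos_const)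
  have add: "(J +> x) \<oplus>\<^bsub>?V\<^esub> (J +> y) = J +> (x \<oplus> y)" if "x \<in> I" "y \<in> I" for x y
    using that by (simp add: quotient_space_def J.a_rcos_sum)
  have smult: "c \<odot>\<^bsub>?V\<^esub> (J +> x) = J +> (a \<otimes> x)"
    if "\<tau> c = \<mm> +> a" "a \<in> carrier R" "x \<in> I" for c a x
    using that by (simp add: quotient_space_def scalar_mult_coset)
  have grp: "abelian_group ?V" by (rule quotient_space_abelian_group)
  have "module K ?V"
  proof (rule moduleI)
    fix c d v w assume c: "c \<in> carrier K" and v: "v \<in> carrier ?V"
    obtain a where a: "a \<in> carrier R" "\<tau> c = \<mm> +> a" using rep[OF c] by auto
    obtain x where x: "x \<in> I" "v = J +> x" using v by (auto simp: carrier)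
    show "c \<odot>\<^bsub>?V\<^esub> v \<in> carrier ?V"
      using a x I.I_l_closed by (simp add: smult carrier)
    {
      assume d: "d \<in> carrier K"
      obtain b where b: "b \<in> carrier R" "\<tau> d = \<mm> +> b" using rep[OF d] by auto
      have "\<tau> (c \<oplus>\<^bsub>K\<^esub> d) = \<mm> +> (a \<oplus> b)"
        using ring_hom_add[OF hom c d] a b by (simp add: FactRing_def a_rcos_sum)
      then show "(c \<oplus>\<^bsub>K\<^esub> d) \<odot>\<^bsub>?V\<^esub> v = c \<odot>\<^bsub>?V\<^esub> v \<oplus>\<^bsub>?V\<^esub> d \<odot>\<^bsub>?V\<^esub> v"
        using a b x I.I_l_closed by (simp add: smult[of _ "a \<oplus> b"] smult[OF a(2,1)] smult[OF b(2,1)] add l_distr)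
      have "\<tau> (c \<otimes>\<^bsub>K\<^esub> d) = \<mm> +> (a \<otimes> b)"
        using ring_hom_mult[OF hom c d] a b by (simp add: FactRing_def rcoset_mult_add)
      then show "(c \<otimes>\<^bsub>K\<^esub> d) \<odot>\<^bsub>?V\<^esub> v = c \<odot>\<^bsub>?V\<^esub> (d \<odot>\<^bsub>?V\<^esub> v)"
        using a b x I.I_l_closed by (simp add: smult[of _ "a \<otimes> b"] smult[OF a(2,1)] smult[OF b(2,1)] m_assoc)
    }
    {
      assume w: "w \<in> carrier ?V"
      obtain y where y: "y \<in> I" "w = J +> y" using w by (auto simp: carrier)
      show "c \<odot>\<^bsub>?V\<^esub> (v \<oplus>\<^bsub>?V\<^esub> w) = c \<odot>\<^bsub>?V\<^esub> v \<oplus>\<^bsub>?V\<^esub> c \<odot>\<^bsub>?V\<^esub> w"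
        using a x y I.I_l_closed by (simp add: smult[OF a(2,1)] add r_distr)
    }
  next
    fix v assume v: "v \<in> carrier ?V"
    obtain x where x: "x \<in> I" "v = J +> x" using v by (auto simp: carrier)
    have "\<tau> \<one>\<^bsub>K\<^esub> = \<mm> +> \<one>" using ring_hom_one[OF hom] by (simp add: FactRing_def)
    then show "\<one>\<^bsub>K\<^esub> \<odot>\<^bsub>?V\<^esub> v = v" using x by (simp add: smult)
  qed (use K.is_cring grp in auto)
  then show ?thesis using K by (simp add: is_vector_space_def)
qed

text \<open>The map \<open>1 + x \<mapsto> x\<close> becomes multiplicative-to-additive modulo \<open>J\<close>, since
  \<open>(1 + x)(1 + y) = 1 + x + y + xy\<close> and \<open>xy \<in> \<mm>I \<subseteq> J\<close>.\<close>

lemma one_plus_quotient_iso: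
  "(one_plus R I Mod carrier (one_plus R J)) \<cong> add_monoid (quotient_space \<tau> I J)"
proof -
  let ?Q = "quotient_space \<tau> I J"
  let ?V = "add_monoid ?Q"
  let ?h = "\<lambda>u. J +> (u \<ominus> \<one>)"
  interpret H: comm_group "one_plus R I" by (rule one_plus_comm_group[OF I Im])
  have h: "?h (\<one> \<oplus> x) = J +> x" if "x \<in> I" for x
    using that by (simp add: a_minus_def a_ac r_neg2 r_neg1 r_neg)
  have carrier: "carrier ?Q = (\<lambda>x. J +> x) ` I" and zero: "\<zero>\<^bsub>?Q\<^esub> = J +> \<zero>"
    by (simp_all add: quotient_space_def J.a_rcos_const)
  have add: "(J +> x) \<oplus>\<^bsub>?Q\<^esub> (J +> y) = J +> (x \<oplus> y)" if "x \<in> I" "y \<in> I" for x y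
    using that by (simp add: quotient_space_def J.a_rcos_sum)
  have shift: "J +> (j \<oplus> x) = J +> x" if "j \<in> J" "x \<in> I" for j x
    using that by (intro J.a_repr_independence'[symmetric]) (auto simp: a_r_coset_def')
  have hom: "?h \<in> hom (one_plus R I) ?V"
  proof (rule homI)
    fix u v assume "u \<in> carrier (one_plus R I)" "v \<in> carrier (one_plus R I)"
    then obtain x y where x: "x \<in> I" "u = \<one> \<oplus> x" and y: "y \<in> I" "v = \<one> \<oplus> y"
      by (auto simp: one_plus_simps)
    have xc: "x \<in> carrier R" and yc: "y \<in> carrier R" using x y I.Icarr by auto
    have xy: "x \<otimes> y \<in> J" using mI x y Im by auto
    have eq: "u \<otimes> v = \<one> \<oplus> (x \<otimes> y \<oplus> (x \<oplus> y))"
      unfolding x y using xc yc by (simp add: l_distr r_distr a_ac)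
    have "?h (u \<otimes> v) = J +> (x \<otimes> y \<oplus> (x \<oplus> y))"
      unfolding eq using x y xy JI by (intro h) auto
    also have "\<dots> = J +> (x \<oplus> y)" using xy x y by (intro shift) auto
    finally show "?h (u \<otimes>\<^bsub>one_plus R I\<^esub> v) = ?h u \<otimes>\<^bsub>?V\<^esub> ?h v"
      using x y by (simp add: one_plus_simps h add)
  next
    fix u assume "u \<in> carrier (one_plus R I)"
    then show "?h u \<in> carrier ?V" using h by (auto simp: one_plus_simps carrier)
  qed
  have grp: "group ?V"
    using abelian_group.a_group[OF quotient_space_abelian_group] .
  interpret h: group_hom "one_plus R I" ?V ?h
    by (intro group_hom.intro group_hom_axioms.intro H.is_group grp hom)
  have "?h ` carrier (one_plus R I) = carrier ?V"
    using h by (simp add: carrier one_plus_simps image_image cong: image_cong)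
  moreover have "kernel (one_plus R I) ?V ?h = carrier (one_plus R J)"
  proof -
    have "J +> x = J \<longleftrightarrow> x \<in> J" if "x \<in> I" for x
      using that J.a_rcos_const J.a_rcos_self by (metis I.Icarr)
    then show ?thesis
      using h JI by (auto simp: kernel_def zero J.a_rcos_const one_plus_simps)
  qed
  ultimately show ?thesis using h.FactGroup_iso by simp
qed

end

end

section \<open>The unit group of a finite local ring\<close>

lemma (in cring) additive_order_prime_power:
  fixes p e :: nat
  assumes p: "Factorial_Ring.prime p" and fin: "finite (carrier R)" and char: "[(p ^ e)] \<cdot> \<one> = \<zero>"
  shows "\<exists>a. card (carrier R) = p ^ a"
proof -
  have "x [^]\<^bsub>add_monoid R\<^esub> (p ^ e) = \<one>\<^bsub>add_monoid R\<^esub>" if x: "x \<in> carrier (add_monoid R)" for x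
  proof -
    have "[(p ^ e)] \<cdot> x = ([(p ^ e)] \<cdot> \<one>) \<otimes> x"
      using x add_pow_ldistr[of \<one> x "p ^ e"] by simp
    then show ?thesis using x char by (simp add: add_pow_def)
  qed
  then show ?thesis
    using group.order_prime_power[OF a_group p, of e] fin by (simp add: order_def)
qed

lemma nat_pow_one_plus: "x [^]\<^bsub>one_plus R I\<^esub> (n::nat) = x [^]\<^bsub>R\<^esub> n"
  by (simp add: nat_pow_def one_plus_simps)

context finite_local
begin

lemma quotient_field: "field (R Quot \<mm>)"
  by (rule quotient_is_field[OF is_cring])

lemma carrier_quotient: "carrier (R Quot \<mm>) = (\<lambda>x. \<mm> +> x) ` carrier R"
  by (auto simp: FactRing_def A_RCOSETS_def')

lemma finite_quotient: "finite (carrier (R Quot \<mm>))"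
  unfolding carrier_quotient by (intro finite_imageI finite_carrier)

lemma quotient_zero_iff: "x \<in> carrier R \<Longrightarrow> \<mm> +> x = \<zero>\<^bsub>R Quot \<mm>\<^esub> \<longleftrightarrow> x \<in> \<mm>"
  using a_rcos_const a_rcos_self by (auto simp: FactRing_def)

lemma card_carrier: "card (carrier R) = card (carrier (R Quot \<mm>)) * card \<mm>"
  using a_lagrange[OF finite_carrier is_additive_subgroup] by (simp add: FactRing_def order_def)

lemma finite_maximal_ideal: "finite \<mm>"
  using finite_carrier a_subset by (rule finite_subset[rotated])

lemma card_Units: "card (Units R) = (card (carrier (R Quot \<mm>)) - 1) * card \<mm>"
  unfolding Units_eq using card_Diff_subset[OF finite_maximal_ideal a_subset] card_carrier
  by (simp add: diff_mult_distrib)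

lemma card_Units_quotient: "card (Units (R Quot \<mm>)) = card (carrier (R Quot \<mm>)) - 1"
proof -
  interpret k: field "R Quot \<mm>" by (rule quotient_field)
  show ?thesis unfolding k.field_Units using finite_quotient by (simp add: card_Diff_singleton)
qed

lemma quotient_one_imp:
  assumes "x \<in> carrier R" "\<mm> +> x = \<one>\<^bsub>R Quot \<mm>\<^esub>"
  shows "x \<in> carrier (one_plus R \<mm>)"
proof -
  have "x \<in> \<mm> +> \<one>" using assms a_rcos_self by (auto simp: FactRing_def)
  then obtain h where "h \<in> \<mm>" "x = h \<oplus> \<one>" by (auto simp: a_r_coset_def')
  then show ?thesis by (auto simp: one_plus_simps a_comm)
qed

lemma ideal_pow_props:
  shows "ideal (ideal_pow R \<mm> i) R"
    and "ideal_pow R \<mm> (Suc i) = ideal_prod R (ideal_pow R \<mm> i) \<mm>"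
    and "ideal_pow R \<mm> (Suc i) \<subseteq> ideal_pow R \<mm> i"
    and "ideal_pow R \<mm> (Suc i) \<subseteq> \<mm>"
proof -
  interpret S: comm_monoid "ideals_set R" by (rule ideals_set_is_comm_monoid)
  have "\<mm> \<in> carrier (ideals_set R)" using is_ideal by (simp add: ideals_set_def)
  then have "ideal_pow R \<mm> i \<in> carrier (ideals_set R)" by (rule S.nat_pow_closed)
  then show id: "ideal (ideal_pow R \<mm> i) R" by (simp add: ideals_set_def)
  show eq: "ideal_pow R \<mm> (Suc i) = ideal_prod R (ideal_pow R \<mm> i) \<mm>"
    unfolding S.nat_pow_Suc by (simp add: ideals_set_def)
  show "ideal_pow R \<mm> (Suc i) \<subseteq> ideal_pow R \<mm> i" "ideal_pow R \<mm> (Suc i) \<subseteq> \<mm>"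
    unfolding eq using ideal_prod_inter[OF id is_ideal] by blast+
qed

context
  fixes p e :: nat
  assumes p: "Factorial_Ring.prime p" and char: "[(p ^ e)] \<cdot> \<one> = \<zero>"
begin

lemma card_quotient: "\<exists>l\<ge>1. card (carrier (R Quot \<mm>)) = p ^ l"
proof -
  interpret k: field "R Quot \<mm>" by (rule quotient_field)
  have "[(p ^ e)] \<cdot>\<^bsub>R Quot \<mm>\<^esub> \<one>\<^bsub>R Quot \<mm>\<^esub> = \<mm> +> ([(p ^ e)] \<cdot> \<one>)"
    using ring_hom_add_pow[OF ring_axioms k.ring_axioms rcos_ring_hom one_closed, of "p ^ e"]
      ring_hom_one[OF rcos_ring_hom] by simp
  also have "\<dots> = \<zero>\<^bsub>R Quot \<mm>\<^esub>"
    unfolding char using ring_hom_zero[OF rcos_ring_hom ring_axioms k.ring_axioms] by simp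
  finally obtain l where l: "card (carrier (R Quot \<mm>)) = p ^ l"
    using k.additive_order_prime_power[OF p finite_quotient] by auto
  have "card {\<zero>\<^bsub>R Quot \<mm>\<^esub>, \<one>\<^bsub>R Quot \<mm>\<^esub>} \<le> card (carrier (R Quot \<mm>))"
    by (intro card_mono finite_quotient) simp
  then have "l \<noteq> 0" using l by (intro notI) simp
  then show ?thesis using l by (intro exI[of _ l]) simp
qed

lemma card_maximal_ideal: "\<exists>s. card \<mm> = p ^ s"
proof -
  obtain a where "card (carrier R) = p ^ a"
    using additive_order_prime_power[OF p finite_carrier char] by auto
  then have "card \<mm> dvd p ^ a" using card_carrier by (metis dvd_triv_right)
  then show ?thesis using p by (metis divides_primepow_nat)
qed

lemma one_plus_p_group: "p_group p (one_plus R \<mm>)"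
proof -
  interpret H: comm_group "one_plus R \<mm>" by (intro one_plus_comm_group is_ideal order_refl)
  obtain s where s: "card \<mm> = p ^ s" using card_maximal_ideal ..
  have "\<exists>n. H.ord x = p ^ n" if "x \<in> carrier (one_plus R \<mm>)" for x
  proof -
    have "H.ord x dvd p ^ s"
      using H.ord_dvd_group_order[OF that] order_one_plus[OF a_subset] s by simp
    then show ?thesis using p by (metis divides_primepow_nat)
  qed
  then show ?thesis unfolding p_group_def using H.is_group by blast
qed

text \<open>Let \<open>q\<close> be the order of the residue field. Raising to the power \<open>q - 1\<close> has trivial kernel
  on the \<open>p\<close>-group \<open>1 + \<mm>\<close>, because \<open>q - 1\<close> is prime to \<open>p\<close>.\<close>

lemma one_plus_pow_eq_one:
  assumes x: "x \<in> carrier (one_plus R \<mm>)" and eq: "x [^] (card (carrier (R Quot \<mm>)) - 1) = \<one>"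
  shows "x = \<one>"
proof -
  interpret H: comm_group "one_plus R \<mm>" by (intro one_plus_comm_group is_ideal order_refl)
  obtain l where l: "l \<ge> 1" "card (carrier (R Quot \<mm>)) = p ^ l" using card_quotient by blast
  obtain s where s: "card \<mm> = p ^ s" using card_maximal_ideal ..
  have "H.ord x dvd p ^ l - 1"
    using eq l(2) H.pow_eq_id[OF x] by (simp add: nat_pow_one_plus one_plus_simps)
  moreover have "H.ord x dvd p ^ s"
    using H.ord_dvd_group_order[OF x] order_one_plus[OF a_subset] s by simp
  moreover have "coprime (p ^ l - 1) (p ^ s)"
  proof -
    have "p ^ l > 0" using prime_gt_0_nat[OF p] by simp
    then have "coprime (p ^ l - 1) (p ^ l)" by (rule coprime_diff_one_left_nat)
    then show ?thesis using l(1) by (simp add: coprime_power_right_iff)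
  qed
  ultimately have "H.ord x = 1" by (metis coprime_common_divisor nat_dvd_1_iff_1)
  then show ?thesis using H.ord_eq_1[OF x] by (simp add: one_plus_simps)
qed

text \<open>The unit group is a direct product without any choice of a complement: \<open>x\<close> is sent to its
  residue class and to \<open>x\<close> raised to the power \<open>q - 1\<close>, which has residue class \<open>1\<close>. The kernel is
  trivial by the previous lemma, and both sides have \<open>(q - 1) |\<mm>|\<close> elements.\<close>

lemma unit_decomposition_iso:
  "(\<lambda>x. (\<mm> +> x, x [^] (card (carrier (R Quot \<mm>)) - 1)))
    \<in> iso (units_of R) (units_of (R Quot \<mm>) \<times>\<times> one_plus R \<mm>)"
proof -
  let ?k = "R Quot \<mm>" and ?H = "one_plus R \<mm>"
  define N where "N = card (carrier ?k) - 1"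
  let ?f = "\<lambda>x. (\<mm> +> x, x [^] N)"
  interpret k: field ?k by (rule quotient_field)
  interpret pi: ring_hom_ring R ?k "\<lambda>x. \<mm> +> x" by (rule rcos_ring_hom_ring)
  interpret U: group "units_of R" by (rule units_group)
  interpret H: comm_group ?H by (intro one_plus_comm_group is_ideal order_refl)
  interpret D: group "units_of ?k \<times>\<times> ?H" by (intro DirProd_group k.units_group H.is_group)
  have pi: "\<mm> +> x \<in> Units ?k" if "x \<in> Units R" for x
    by (rule ring_hom_Units[OF ring_axioms k.ring_axioms rcos_ring_hom that])
  have pow: "x [^] N \<in> carrier ?H" if x: "x \<in> Units R" for x
  proof (rule quotient_one_imp)
    have "(\<mm> +> x) [^]\<^bsub>?k\<^esub> N = \<one>\<^bsub>?k\<^esub>"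
      using k.units_power_order_eq_one[OF _ pi[OF x]] finite_quotient card_Units_quotient
      by (simp add: N_def k.field_Units)
    then show "\<mm> +> (x [^] N) = \<one>\<^bsub>?k\<^esub>" using x by (simp add: pi.hom_nat_pow Units_closed)
  qed (use x in \<open>simp add: Units_closed\<close>)
  have hom: "?f \<in> hom (units_of R) (units_of ?k \<times>\<times> ?H)"
  proof (rule homI)
    show "?f x \<in> carrier (units_of ?k \<times>\<times> ?H)" if "x \<in> carrier (units_of R)" for x
      using that pi pow by (simp add: units_of_carrier)
    show "?f (x \<otimes>\<^bsub>units_of R\<^esub> y) = ?f x \<otimes>\<^bsub>units_of ?k \<times>\<times> ?H\<^esub> ?f y"
      if "x \<in> carrier (units_of R)" "y \<in> carrier (units_of R)" for x y
      using that by (simp add: units_of_carrier units_of_mult one_plus_simps Units_closed nat_pow_distrib)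
  qed
  interpret f: group_hom "units_of R" "units_of ?k \<times>\<times> ?H" ?f
    by (intro group_hom.intro group_hom_axioms.intro U.is_group D.is_group hom)
  have "kernel (units_of R) (units_of ?k \<times>\<times> ?H) ?f = {\<one>\<^bsub>units_of R\<^esub>}"
  proof -
    have "x = \<one>" if "x \<in> Units R" "\<mm> +> x = \<one>\<^bsub>?k\<^esub>" "x [^] N = \<one>" for x
      using that one_plus_pow_eq_one quotient_one_imp by (simp add: N_def Units_closed)
    then show ?thesis
      by (auto simp: kernel_def units_of_carrier units_of_one one_plus_simps)
  qed
  then have inj: "inj_on ?f (carrier (units_of R))" by (rule f.trivial_ker_imp_inj)
  have "?f ` carrier (units_of R) = carrier (units_of ?k \<times>\<times> ?H)"
  proof (rule card_subset_eq)
    have finU: "finite (Units ?k)" unfolding k.field_Units using finite_quotient by simp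
    have finH: "finite (carrier ?H)" unfolding one_plus_simps using finite_maximal_ideal by simp
    show "finite (carrier (units_of ?k \<times>\<times> ?H))"
      using finU finH by (simp add: units_of_carrier)
    show "?f ` carrier (units_of R) \<subseteq> carrier (units_of ?k \<times>\<times> ?H)"
      using f.hom_closed by (rule image_subsetI)
    have "card (carrier (units_of ?k \<times>\<times> ?H)) = card (Units ?k) * card \<mm>"
      using order_one_plus[OF a_subset] by (simp add: units_of_carrier card_cartesian_product order_def)
    then show "card (?f ` carrier (units_of R)) = card (carrier (units_of ?k \<times>\<times> ?H))"
      unfolding card_image[OF inj] by (simp add: units_of_carrier card_Units card_Units_quotient)
  qed
  then show ?thesis
    using hom inj unfolding iso_def bij_betw_def N_def by blast
qed

text \<open>The units \<open>t\<close> whose power of exponent \<open>q - 1\<close> is \<open>1\<close> form a group \<open>T\<close> that maps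
  bijectively onto the nonzero residue classes. Distinct elements of \<open>T\<close> differ by a unit, so \<open>T\<close>
  acts freely on \<open>\<mm> - {0}\<close> by multiplication, and \<open>\<mm> - {0}\<close> is a union of orbits
  of size \<open>q - 1\<close>.\<close>

lemma residue_units_dvd_card_maximal_ideal: "(card (carrier (R Quot \<mm>)) - 1) dvd (card \<mm> - 1)"
proof -
  let ?k = "R Quot \<mm>" and ?H = "one_plus R \<mm>"
  define N where "N = card (carrier ?k) - 1"
  let ?f = "\<lambda>x. (\<mm> +> x, x [^] N)"
  define T where "T = {t \<in> Units R. t [^] N = \<one>}"
  interpret k: field ?k by (rule quotient_field)
  interpret pi: ring_hom_ring R ?k "\<lambda>x. \<mm> +> x" by (rule rcos_ring_hom_ring)
  interpret H: comm_group ?H by (intro one_plus_comm_group is_ideal order_refl)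
  \<comment> \<open>\<open>T\<close> is the preimage of the first factor under the decomposition of the unit group.\<close>
  have bij: "bij_betw ?f (Units R) (Units ?k \<times> carrier ?H)"
    using unit_decomposition_iso by (simp add: iso_def N_def units_of_carrier)
  have "\<one> \<in> carrier ?H" using H.one_closed by (simp add: one_plus_simps)
  have inj: "inj_on (\<lambda>x. \<mm> +> x) T"
    using bij_betw_imp_inj_on[OF bij] unfolding inj_on_def T_def by simp
  have img: "(\<lambda>x. \<mm> +> x) ` T = Units ?k"
  proof
    show "(\<lambda>x. \<mm> +> x) ` T \<subseteq> Units ?k"
      using bij_betw_imp_surj_on[OF bij] unfolding T_def by blast
    show "Units ?k \<subseteq> (\<lambda>x. \<mm> +> x) ` T"
    proof
      fix y assume "y \<in> Units ?k"
      then have "(y, \<one>) \<in> ?f ` Units R"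
        unfolding bij_betw_imp_surj_on[OF bij] using \<open>\<one> \<in> carrier ?H\<close> by simp
      then show "y \<in> (\<lambda>x. \<mm> +> x) ` T" unfolding T_def by auto
    qed
  qed
  have cardT: "card T = N"
    using card_image[OF inj] img card_Units_quotient by (simp add: N_def)
  have T: "t \<in> carrier R" "t \<in> Units R" if "t \<in> T" for t
    using that by (simp_all add: T_def Units_closed)
  have T1: "\<one> \<in> T" by (simp add: T_def)
  have Tm: "s \<otimes> t \<in> T" if "s \<in> T" "t \<in> T" for s t
    using that by (simp add: T_def nat_pow_distrib Units_closed)
  have Ti: "inv t \<in> T" if "t \<in> T" for t
  proof -
    have "t [^] N = \<one>" using that by (simp add: T_def)
    then have "inv t [^] N = inv t [^] N \<otimes> t [^] N" using T[OF that] by simp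
    also have "\<dots> = (inv t \<otimes> t) [^] N" using T[OF that] by (simp only: nat_pow_distrib Units_inv_closed)
    also have "\<dots> = \<one>" using T[OF that] by simp
    finally show ?thesis using T[OF that] by (simp add: T_def)
  qed
  define orb where "orb x = (\<lambda>t. t \<otimes> x) ` T" for x
  let ?M = "\<mm> - {\<zero>}"
  have xc: "x \<in> carrier R" if "x \<in> ?M" for x using that by auto
  have card_orb: "card (orb x) = N" if x: "x \<in> ?M" for x
  proof -
    have "inj_on (\<lambda>t. t \<otimes> x) T"
    proof (rule inj_onI, rule ccontr)
      fix s t assume st: "s \<in> T" "t \<in> T" "s \<otimes> x = t \<otimes> x" "s \<noteq> t"
      have d: "(s \<ominus> t) \<otimes> x = \<zero>"
        using st(3) T[OF st(1)] T[OF st(2)] xc[OF x] by (simp add: a_minus_def l_distr l_minus r_neg)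
      have "s \<ominus> t \<notin> \<mm>"
      proof
        assume "s \<ominus> t \<in> \<mm>"
        then have "(\<mm> +> s) \<ominus>\<^bsub>?k\<^esub> (\<mm> +> t) = \<zero>\<^bsub>?k\<^esub>"
          using quotient_zero_iff[of "s \<ominus> t"] T[OF st(1)] T[OF st(2)] by (simp add: a_minus_def)
        then have "\<mm> +> s = \<mm> +> t"
          using T[OF st(1)] T[OF st(2)] by (simp add: k.r_right_minus_eq)
        then show False using inj st by (metis inj_onD)
      qed
      then have u: "s \<ominus> t \<in> Units R"
        using T[OF st(1)] T[OF st(2)] by (simp add: Units_eq)
      have "inv (s \<ominus> t) \<otimes> ((s \<ominus> t) \<otimes> x) = x"
        using u xc[OF x] by (subst m_assoc[symmetric]) (simp_all add: Units_closed)
      then have "x = \<zero>" using d u by simp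
      then show False using x by simp
    qed
    then show ?thesis unfolding orb_def using cardT by (simp add: card_image)
  qed
  have orb_sub: "orb x \<subseteq> ?M" if x: "x \<in> ?M" for x
  proof
    fix y assume "y \<in> orb x"
    then obtain t where t: "t \<in> T" "y = t \<otimes> x" by (auto simp: orb_def)
    have "inv t \<otimes> y = x"
      unfolding t(2) using T[OF t(1)] xc[OF x] by (subst m_assoc[symmetric]) simp_all
    then have "y \<noteq> \<zero>" using x T[OF t(1)] by (intro notI) simp
    moreover have "y \<in> \<mm>" unfolding t(2) using x T[OF t(1)] by (intro I_l_closed) simp_all
    ultimately show "y \<in> ?M" by simp
  qed
  have orb_self: "x \<in> orb x" if "x \<in> ?M" for x
    unfolding orb_def using T1 xc[OF that] by (intro image_eqI[of _ _ \<one>]) simp_all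
  have orb_le: "orb x \<subseteq> orb y" if x: "x \<in> ?M" and y: "y \<in> ?M" and z: "z \<in> orb x" "z \<in> orb y" for x y z
  proof
    fix w assume "w \<in> orb x"
    then obtain r where r: "r \<in> T" "w = r \<otimes> x" by (auto simp: orb_def)
    obtain s t where st: "s \<in> T" "t \<in> T" "s \<otimes> x = t \<otimes> y" using z by (auto simp: orb_def)
    have "x = inv s \<otimes> (s \<otimes> x)"
      using T[OF st(1)] xc[OF x] by (subst m_assoc[symmetric]) simp_all
    then have "w = (r \<otimes> (inv s \<otimes> t)) \<otimes> y"
      unfolding r(2) st(3) using T[OF st(1)] T[OF st(2)] T[OF r(1)] xc[OF y] by (simp add: m_assoc)
    then show "w \<in> orb y"
      unfolding orb_def using Tm[OF r(1) Tm[OF Ti[OF st(1)] st(2)]] by (rule image_eqI)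
  qed
  have union: "\<Union> (orb ` ?M) = ?M"
    using orb_self orb_sub by blast
  have "N * card (orb ` ?M) = card (\<Union> (orb ` ?M))"
  proof (rule card_partition)
    show "finite (orb ` ?M)" using finite_maximal_ideal by simp
    show "finite (\<Union> (orb ` ?M))" unfolding union using finite_maximal_ideal by simp
    show "card c = N" if "c \<in> orb ` ?M" for c using that card_orb by blast
    show "c \<inter> d = {}" if cd: "c \<in> orb ` ?M" "d \<in> orb ` ?M" "c \<noteq> d" for c d
    proof (rule ccontr)
      assume "c \<inter> d \<noteq> {}"
      then obtain z where "z \<in> c" "z \<in> d" by blast
      moreover obtain x y where "x \<in> ?M" "c = orb x" "y \<in> ?M" "d = orb y" using cd(1,2) by blast
      ultimately have "c = d" using orb_le[of x y z] orb_le[of y x z] by blast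
      then show False using cd(3) by simp
    qed
  qed
  also have "\<dots> = card \<mm> - 1"
    unfolding union using ideal_closures(1)[OF is_ideal] by (simp only: card_Diff_singleton)
  finally show ?thesis unfolding N_def[symmetric] by (metis dvd_triv_left)
qed

theorem unit_group_structure:
  "\<exists>l\<ge>1.
     (R Quot \<mm>) \<simeq> GF (p ^ l) \<and>
     subgroup (carrier (one_plus R \<mm>)) (units_of R) \<and>
     comm_group (one_plus R \<mm>) \<and> p_group p (one_plus R \<mm>) \<and>
     units_of R \<cong> units_of (GF (p ^ l)) \<times>\<times> one_plus R \<mm> \<and>
     (\<forall>i\<ge>1.
        subgroup (carrier (one_plus R (ideal_pow R \<mm> i))) (one_plus R \<mm>) \<and>
        carrier (one_plus R (ideal_pow R \<mm> (i + 1)))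
          \<subseteq> carrier (one_plus R (ideal_pow R \<mm> i)) \<and>
        (\<exists>V :: (nat, 'a set) module. is_vector_space (GF (p ^ l)) V \<and>
           (one_plus R (ideal_pow R \<mm> i) Mod carrier (one_plus R (ideal_pow R \<mm> (i + 1))))
             \<cong> add_monoid V)) \<and>
     (\<exists>k::nat. order (one_plus R \<mm>) = p ^ (l * k)) \<and> card (carrier (R Quot \<mm>)) = p ^ l"
proof -
  let ?k = "R Quot \<mm>"
  interpret k: field ?k by (rule quotient_field)
  obtain l where l: "l \<ge> 1" "card (carrier ?k) = p ^ l" using card_quotient by blast
  note GF = GF_field[OF p l(1)]
  have kGF: "?k \<simeq> GF (p ^ l)"
    by (rule finite_fields_iso[OF p quotient_field l(2) GF(1,3)])
  then have "GF (p ^ l) \<simeq> ?k" by (rule ring_iso_sym[OF k.ring_axioms])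
  then obtain \<tau> where \<tau>: "\<tau> \<in> ring_iso (GF (p ^ l)) ?k" unfolding is_ring_iso_def by blast
  have "units_of ?k \<cong> units_of (GF (p ^ l))"
    by (rule ring_iso_imp_units_iso[OF k.ring_axioms field.is_ring[OF GF(1)] kGF])
  then have "units_of ?k \<times>\<times> one_plus R \<mm> \<cong> units_of (GF (p ^ l)) \<times>\<times> one_plus R \<mm>"
    by (intro group.DirProd_iso_trans k.units_group iso_refl)
  moreover have "units_of R \<cong> units_of ?k \<times>\<times> one_plus R \<mm>"
    using unit_decomposition_iso unfolding is_iso_def by blast
  ultimately have iso: "units_of R \<cong> units_of (GF (p ^ l)) \<times>\<times> one_plus R \<mm>"
    by (rule iso_trans[rotated])
  have filtration: "subgroup (carrier (one_plus R (ideal_pow R \<mm> i))) (one_plus R \<mm>) \<and>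
        carrier (one_plus R (ideal_pow R \<mm> (i + 1))) \<subseteq> carrier (one_plus R (ideal_pow R \<mm> i)) \<and>
        (\<exists>V :: (nat, 'a set) module. is_vector_space (GF (p ^ l)) V \<and>
           (one_plus R (ideal_pow R \<mm> i) Mod carrier (one_plus R (ideal_pow R \<mm> (i + 1))))
             \<cong> add_monoid V)" if i: "i \<ge> 1" for i
  proof -
    let ?I = "ideal_pow R \<mm> i" and ?J = "ideal_pow R \<mm> (i + 1)"
    obtain j where j: "i = Suc j" using i by (cases i) simp_all
    have I: "ideal ?I R" and J: "ideal ?J R" by (rule ideal_pow_props(1))+
    have Im: "?I \<subseteq> \<mm>" unfolding j by (rule ideal_pow_props(4))
    have JI: "?J \<subseteq> ?I" using ideal_pow_props(3)[of i] by simp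
    have mI: "a \<otimes> x \<in> ?J" if "a \<in> \<mm>" "x \<in> ?I" for a x
    proof -
      have "x \<otimes> a \<in> ideal_prod R ?I \<mm>" using that(2,1) by (rule ideal_prod.prod)
      moreover have "x \<in> carrier R" using that(2) by (rule ideal.Icarr[OF I])
      ultimately show ?thesis using that(1) ideal_pow_props(2)[of i] by (simp add: m_comm)
    qed
    have "is_vector_space (GF (p ^ l)) (quotient_space \<tau> ?I ?J)"
      by (rule quotient_space_vector_space[OF I J JI Im mI GF(1) \<tau>])
    moreover have "(one_plus R ?I Mod carrier (one_plus R ?J)) \<cong> add_monoid (quotient_space \<tau> ?I ?J)"
      by (rule one_plus_quotient_iso[OF I J JI Im mI])
    moreover have "subgroup (carrier (one_plus R ?I)) (one_plus R \<mm>)"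
      by (rule one_plus_subgroup_mono[OF is_ideal order_refl I Im])
    moreover have "carrier (one_plus R ?J) \<subseteq> carrier (one_plus R ?I)"
      unfolding one_plus_simps using JI by (rule image_mono)
    ultimately show ?thesis by blast
  qed
  obtain s where s: "card \<mm> = p ^ s" using card_maximal_ideal ..
  have "l dvd s"
    using dvd_power_diff_one_imp_dvd[of p l s] residue_units_dvd_card_maximal_ideal l s prime_ge_2_nat[OF p] by simp
  then have "\<exists>k. order (one_plus R \<mm>) = p ^ (l * k)"
    using order_one_plus[OF a_subset] s by auto
  then show ?thesis
    using l kGF iso filtration one_plus_p_group one_plus_subgroup[OF is_ideal order_refl]
      one_plus_comm_group[OF is_ideal order_refl] by (intro exI[of _ l]) blast
qed

end

end

section \<open>Recognising local rings, fields and the characteristic\<close>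

lemma (in cring) local_ring_of_nonunits:
  assumes I: "ideal I R" and units: "Units R = carrier R - I"
  shows "local_ring R I"
proof -
  have one: "\<one> \<notin> I"
    using units Units_one_closed by (metis DiffD2)
  have proper: "J \<subseteq> I" if J: "ideal J R" "J \<noteq> carrier R" for J
  proof
    fix x assume x: "x \<in> J"
    have xc: "x \<in> carrier R" using x by (rule ideal.Icarr[OF J(1)])
    show "x \<in> I"
    proof (rule ccontr)
      assume "x \<notin> I"
      then have u: "x \<in> Units R" using units xc by simp
      then have "inv x \<otimes> x \<in> J" using x by (intro ideal.I_l_closed[OF J(1)]) simp_all
      then have "\<one> \<in> J" using u by simp
      then show False using ideal.one_imp_carrier[OF J(1)] J(2) by simp
    qed
  qed
  have max: "maximalideal I R"
  proof (rule maximalidealI[OF I])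
    show "carrier R \<noteq> I" using one one_closed by metis
    fix J assume "ideal J R" "I \<subseteq> J" "J \<subseteq> carrier R"
    then show "J = I \<or> J = carrier R" using proper by blast
  qed
  have "M = I" if M: "maximalideal M R" for M
  proof -
    interpret M: maximalideal M R by fact
    have "M \<subseteq> I" using proper[OF M.is_ideal] M.I_notcarr by simp
    moreover have "I \<subseteq> carrier R" using ideal.Icarr[OF I] by blast
    ultimately show ?thesis
      using M.I_maximal[OF I] one one_closed by metis
  qed
  then show ?thesis unfolding local_ring_def using is_cring max by blast
qed

text \<open>An isomorphism carries the maximal ideal to a maximal ideal of the same size.\<close>

lemma local_ring_transport:
  assumes A: "local_ring A \<mm>" "finite (carrier A)" and S: "ring S" and iso: "A \<simeq> S"
  shows "\<exists>\<nn>. local_ring S \<nn> \<and> card \<nn> = card \<mm>"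
proof -
  interpret A: finite_local A \<mm> by (rule finite_localI[OF A])
  interpret S: cring S by (rule ring_iso_cring[OF A.is_cring S iso])
  have "S \<simeq> A" by (rule ring_iso_sym[OF A.ring_axioms iso])
  then obtain g where g: "g \<in> ring_iso S A" unfolding is_ring_iso_def by blast
  have hom: "g \<in> ring_hom S A" and bij: "bij_betw g (carrier S) (carrier A)"
    using g by (simp_all add: ring_iso_def)
  have inv: "inv_into (carrier S) g \<in> ring_hom A S"
    using ring_iso_set_sym[OF S g] by (simp add: ring_iso_def)
  interpret g: ring_hom_ring S A g by (rule ring_hom_ringI2[OF S A.ring_axioms hom])
  define \<nn> where "\<nn> = {s \<in> carrier S. g s \<in> \<mm>}"
  have n: "ideal \<nn> S" unfolding \<nn>_def by (rule g.ideal_vimage[OF A.is_ideal])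
  have "Units S = carrier S - \<nn>"
  proof
    show "Units S \<subseteq> carrier S - \<nn>"
    proof
      fix s assume s: "s \<in> Units S"
      then have "g s \<in> Units A" by (rule ring_hom_Units[OF S A.ring_axioms hom])
      then show "s \<in> carrier S - \<nn>" using s by (simp add: A.Units_eq \<nn>_def S.Units_closed)
    qed
    show "carrier S - \<nn> \<subseteq> Units S"
    proof
      fix s assume s: "s \<in> carrier S - \<nn>"
      then have "g s \<in> Units A" by (simp add: A.Units_eq \<nn>_def)
      then have "inv_into (carrier S) g (g s) \<in> Units S"
        by (rule ring_hom_Units[OF A.ring_axioms S inv])
      then show "s \<in> Units S" using s bij by (simp add: bij_betw_inv_into_left)
    qed
  qed
  then have local: "local_ring S \<nn>" by (rule S.local_ring_of_nonunits[OF n])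
  have "bij_betw g \<nn> \<mm>"
    unfolding bij_betw_def
  proof
    show "inj_on g \<nn>" by (rule inj_on_subset[OF bij_betw_imp_inj_on[OF bij]]) (simp add: \<nn>_def)
    have "\<mm> \<subseteq> g ` carrier S"
      unfolding bij_betw_imp_surj_on[OF bij] by (rule A.a_subset)
    then show "g ` \<nn> = \<mm>" unfolding \<nn>_def by blast
  qed
  then have "card \<nn> = card \<mm>" by (rule bij_betw_same_card)
  with local show ?thesis by blast
qed

lemma (in field) local_ring_zero: "local_ring R {\<zero>}"
  by (rule local_ring_of_nonunits[OF zeroideal]) (simp add: field_Units)

lemma (in domain) reduced: "reduced_ring R"
  unfolding reduced_ring_def using nat_pow_nonzero by blast

lemma (in finite_local) reduced_imp_field:
  assumes "reduced_ring R"
  shows "field R"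
proof -
  have "\<mm> = {\<zero>}"
  proof
    show "\<mm> \<subseteq> {\<zero>}"
    proof
      fix x assume x: "x \<in> \<mm>"
      from mem_nilpotent[OF x] obtain n :: nat where "x [^] n = \<zero>" ..
      then show "x \<in> {\<zero>}" using assms Icarr[OF x] unfolding reduced_ring_def by blast
    qed
    show "{\<zero>} \<subseteq> \<mm>" using ideal_closures(1)[OF is_ideal] by blast
  qed
  then show ?thesis using zeromaximalideal_fieldI is_maximalideal by simp
qed

lemma (in cring) ring_char_pow: "[(ring_char R)] \<cdot> \<one> = \<zero>"
  using group.pow_ord_eq_1[OF a_group, of \<one>] by (simp add: ring_char_def add_pow_def)

lemma (in cring) ring_char_prime_power:
  fixes p n :: nat
  assumes "Factorial_Ring.prime p" "[(p ^ n)] \<cdot> \<one> = \<zero>"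
  shows "\<exists>e. ring_char R = p ^ e"
proof -
  have "ring_char R dvd p ^ n"
    using group.pow_eq_id[OF a_group, of \<one> "p ^ n"] assms(2) by (simp add: ring_char_def add_pow_def)
  then show ?thesis using assms(1) by (metis divides_primepow_nat)
qed

section \<open>Trivial extensions\<close>

text \<open>The trivial extension of a ring \<open>R\<close> by an \<open>R\<close>-module \<open>M\<close>: the group \<open>R \<times> M\<close>,
  in which \<open>M\<close> is an ideal of square zero.\<close>

definition trivial_extension :: "('a, 'm) ring_scheme \<Rightarrow> ('a, 'b, 'n) module_scheme \<Rightarrow> ('a \<times> 'b) ring"
  where "trivial_extension R M = \<lparr>carrier = carrier R \<times> carrier M,
    monoid.mult = (\<lambda>(a, x) (b, y). (a \<otimes>\<^bsub>R\<^esub> b, (a \<odot>\<^bsub>M\<^esub> y) \<oplus>\<^bsub>M\<^esub> (b \<odot>\<^bsub>M\<^esub> x))),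
    one = (\<one>\<^bsub>R\<^esub>, \<zero>\<^bsub>M\<^esub>),
    ring.zero = (\<zero>\<^bsub>R\<^esub>, \<zero>\<^bsub>M\<^esub>),
    ring.add = (\<lambda>(a, x) (b, y). (a \<oplus>\<^bsub>R\<^esub> b, x \<oplus>\<^bsub>M\<^esub> y))\<rparr>"

lemma trivial_extension_simps:
  "carrier (trivial_extension R M) = carrier R \<times> carrier M"
  "(a, x) \<otimes>\<^bsub>trivial_extension R M\<^esub> (b, y) = (a \<otimes>\<^bsub>R\<^esub> b, (a \<odot>\<^bsub>M\<^esub> y) \<oplus>\<^bsub>M\<^esub> (b \<odot>\<^bsub>M\<^esub> x))"
  "\<one>\<^bsub>trivial_extension R M\<^esub> = (\<one>\<^bsub>R\<^esub>, \<zero>\<^bsub>M\<^esub>)"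
  "\<zero>\<^bsub>trivial_extension R M\<^esub> = (\<zero>\<^bsub>R\<^esub>, \<zero>\<^bsub>M\<^esub>)"
  "(a, x) \<oplus>\<^bsub>trivial_extension R M\<^esub> (b, y) = (a \<oplus>\<^bsub>R\<^esub> b, x \<oplus>\<^bsub>M\<^esub> y)"
  by (simp_all add: trivial_extension_def)

lemma (in module) trivial_extension_cring: "cring (trivial_extension R M)"
proof (rule cringI)
  let ?A = "trivial_extension R M"
  show "abelian_group ?A"
  proof (rule abelian_groupI)
    show "\<exists>w\<in>carrier ?A. w \<oplus>\<^bsub>?A\<^esub> v = \<zero>\<^bsub>?A\<^esub>" if v: "v \<in> carrier ?A" for v
    proof -
      obtain a x where ax: "v = (a, x)" "a \<in> carrier R" "x \<in> carrier M"
        using v by (auto simp: trivial_extension_simps)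
      then show ?thesis
        by (intro bexI[of _ "(\<ominus> a, \<ominus>\<^bsub>M\<^esub> x)"]) (simp_all add: trivial_extension_simps R.l_neg M.l_neg)
    qed
  qed (auto simp: trivial_extension_simps R.a_ac M.a_ac)
  show "comm_monoid ?A"
  proof (rule comm_monoidI)
    fix u v w assume "u \<in> carrier ?A" "v \<in> carrier ?A" "w \<in> carrier ?A"
    then obtain a b c x y z where "u = (a, x)" "v = (b, y)" "w = (c, z)"
      "a \<in> carrier R" "b \<in> carrier R" "c \<in> carrier R" "x \<in> carrier M" "y \<in> carrier M" "z \<in> carrier M"
      by (auto simp: trivial_extension_simps)
    then show "u \<otimes>\<^bsub>?A\<^esub> v \<otimes>\<^bsub>?A\<^esub> w = u \<otimes>\<^bsub>?A\<^esub> (v \<otimes>\<^bsub>?A\<^esub> w)"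
      by (simp add: trivial_extension_simps R.m_ac smult_r_distr M.a_ac flip: smult_assoc1)
  qed (auto simp: trivial_extension_simps R.m_comm M.a_comm)
  fix u v w assume "u \<in> carrier ?A" "v \<in> carrier ?A" "w \<in> carrier ?A"
  then obtain a b c x y z where "u = (a, x)" "v = (b, y)" "w = (c, z)"
    "a \<in> carrier R" "b \<in> carrier R" "c \<in> carrier R" "x \<in> carrier M" "y \<in> carrier M" "z \<in> carrier M"
    by (auto simp: trivial_extension_simps)
  then show "(u \<oplus>\<^bsub>?A\<^esub> v) \<otimes>\<^bsub>?A\<^esub> w = u \<otimes>\<^bsub>?A\<^esub> w \<oplus>\<^bsub>?A\<^esub> v \<otimes>\<^bsub>?A\<^esub> w"
    by (simp add: trivial_extension_simps R.l_distr smult_l_distr smult_r_distr M.a_ac)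
qed

lemma trivial_extension_embed:
  assumes "module R M"
  shows "(\<lambda>a. (a, \<zero>\<^bsub>M\<^esub>)) \<in> ring_hom R (trivial_extension R M)"
proof -
  interpret module R M by fact
  show ?thesis
    by (rule ring_hom_memI) (simp_all add: trivial_extension_simps)
qed

lemma trivial_extension_local:
  assumes F: "field F" and M: "module F M"
  shows "local_ring (trivial_extension F M) ({\<zero>\<^bsub>F\<^esub>} \<times> carrier M)"
proof -
  interpret F: field F by fact
  let ?A = "trivial_extension F M" and ?I = "{\<zero>\<^bsub>F\<^esub>} \<times> carrier M"
  have kernel: "a_kernel ?A F fst = ?I"
    using F.zero_closed unfolding a_kernel_def' trivial_extension_simps by fastforce
  have rep: "\<exists>a x. v = (a, x) \<and> a \<in> carrier F \<and> a \<noteq> \<zero>\<^bsub>F\<^esub> \<and> x \<in> carrier M"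
    if "v \<in> carrier ?A - ?I" for v
    using that unfolding trivial_extension_simps by blast
  have proj: "fst \<in> ring_hom ?A F"
    by (rule ring_hom_memI) (auto simp: trivial_extension_simps)
  interpret M: module F M by fact
  interpret A: cring ?A by (rule M.trivial_extension_cring)
  note simps = trivial_extension_simps
  interpret fst: ring_hom_ring ?A F fst
    by (rule ring_hom_ringI2[OF A.ring_axioms F.ring_axioms proj])
  have I: "ideal ?I ?A" using fst.kernel_is_ideal unfolding kernel .
  have "Units ?A = carrier ?A - ?I"
  proof
    show "Units ?A \<subseteq> carrier ?A - ?I"
    proof
      fix v assume v: "v \<in> Units ?A"
      then have "fst v \<in> Units F" by (rule ring_hom_Units[OF A.ring_axioms F.ring_axioms proj])
      then have "v \<notin> ?I" unfolding F.field_Units by (cases v) simp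
      then show "v \<in> carrier ?A - ?I" using v by (simp add: A.Units_closed)
    qed
    show "carrier ?A - ?I \<subseteq> Units ?A"
    proof
      fix v assume v: "v \<in> carrier ?A - ?I"
      from rep[OF this] obtain a x
        where ax: "v = (a, x)" "a \<in> carrier F" "a \<noteq> \<zero>\<^bsub>F\<^esub>" "x \<in> carrier M"
        by (elim exE conjE)
      then have u: "a \<in> Units F" by (simp add: F.field_Units)
      \<comment> \<open>The inverse of \<open>(a, x)\<close> is \<open>(b, - b (b x))\<close> with \<open>b\<close> the inverse of \<open>a\<close>.\<close>
      let ?b = "inv\<^bsub>F\<^esub> a"
      let ?y = "\<ominus>\<^bsub>M\<^esub> (?b \<odot>\<^bsub>M\<^esub> (?b \<odot>\<^bsub>M\<^esub> x))"
      have b: "?b \<in> carrier F" using u by simp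
      have "a \<odot>\<^bsub>M\<^esub> ?y = \<ominus>\<^bsub>M\<^esub> ((a \<otimes>\<^bsub>F\<^esub> ?b) \<odot>\<^bsub>M\<^esub> (?b \<odot>\<^bsub>M\<^esub> x))"
        using ax b by (simp add: M.smult_r_minus M.smult_assoc1)
      also have "\<dots> = \<ominus>\<^bsub>M\<^esub> (?b \<odot>\<^bsub>M\<^esub> x)" using u ax b by simp
      finally have eq: "a \<odot>\<^bsub>M\<^esub> ?y \<oplus>\<^bsub>M\<^esub> ?b \<odot>\<^bsub>M\<^esub> x = \<zero>\<^bsub>M\<^esub>"
        using ax b by (simp add: M.M.l_neg)
      have w: "(?b, ?y) \<in> carrier ?A" using ax b by (simp add: simps)
      have "v \<otimes>\<^bsub>?A\<^esub> (?b, ?y) = \<one>\<^bsub>?A\<^esub>"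
        using u eq by (simp add: ax(1) simps)
      moreover have "(?b, ?y) \<otimes>\<^bsub>?A\<^esub> v = v \<otimes>\<^bsub>?A\<^esub> (?b, ?y)"
        using w v by (intro A.m_comm) simp_all
      ultimately show "v \<in> Units ?A"
        unfolding Units_def using v w by (intro CollectI conjI bexI[of _ "(?b, ?y)"]) simp_all
    qed
  qed
  then show ?thesis by (rule A.local_ring_of_nonunits[OF I])
qed

text \<open>The free module \<open>R\<^sup>k\<close>, as extensional functions on \<open>{..<k}\<close>; its multiplication and unit are
  irrelevant for the module structure.\<close>

definition free_module :: "('a, 'm) ring_scheme \<Rightarrow> nat \<Rightarrow> ('a, nat \<Rightarrow> 'a) module"
  where "free_module R k = \<lparr>carrier = {..<k} \<rightarrow>\<^sub>E carrier R,
    monoid.mult = (\<lambda>f g. f), one = (\<lambda>i\<in>{..<k}. \<zero>\<^bsub>R\<^esub>),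
    ring.zero = (\<lambda>i\<in>{..<k}. \<zero>\<^bsub>R\<^esub>),
    ring.add = (\<lambda>f g. \<lambda>i\<in>{..<k}. f i \<oplus>\<^bsub>R\<^esub> g i),
    smult = (\<lambda>a f. \<lambda>i\<in>{..<k}. a \<otimes>\<^bsub>R\<^esub> f i)\<rparr>"

lemma (in cring) free_module: "module R (free_module R k)"
proof (rule moduleI)
  let ?M = "free_module R k"
  note simps = free_module_def
  show "abelian_group ?M"
  proof (rule abelian_groupI)
    show "\<exists>g\<in>carrier ?M. g \<oplus>\<^bsub>?M\<^esub> f = \<zero>\<^bsub>?M\<^esub>" if "f \<in> carrier ?M" for f
      using that
      by (intro bexI[of _ "\<lambda>i\<in>{..<k}. \<ominus> (f i)"])
         (auto simp: simps PiE_iff l_neg intro!: restrict_ext)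
    show "\<zero>\<^bsub>?M\<^esub> \<oplus>\<^bsub>?M\<^esub> f = f" if "f \<in> carrier ?M" for f
      using that by (auto simp: simps PiE_iff extensional_def fun_eq_iff)
  qed (auto simp: simps PiE_iff a_ac intro!: restrict_ext)
  show "\<one> \<odot>\<^bsub>?M\<^esub> f = f" if "f \<in> carrier ?M" for f
    using that by (auto simp: simps PiE_iff extensional_def fun_eq_iff)
qed (auto simp: free_module_def PiE_iff l_distr r_distr m_assoc is_cring intro!: restrict_ext)

text \<open>The trivial extension of \<open>F\<close>, the field with \<open>p\<^sup>l\<close> elements, by \<open>F\<^sup>k\<close> has a maximal
  ideal of the prescribed size, so the structure theorem applies to it.\<close>

lemma exists_local_ring:
  fixes p l k :: nat
  assumes p: "Factorial_Ring.prime p" and l: "l \<ge> 1"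
  shows "\<exists>(A::nat ring) \<mm> (H::nat monoid).
    local_ring A \<mm> \<and> finite (carrier A) \<and> (\<exists>e::nat. ring_char A = p ^ e) \<and>
    comm_group H \<and> p_group p H \<and> order H = p ^ (l * k) \<and>
    units_of A \<cong> units_of (GF (p ^ l)) \<times>\<times> H"
proof -
  let ?F = "GF (p ^ l)"
  note GF = GF_field[OF p l]
  interpret F: field ?F by (rule GF(1))
  let ?M = "free_module ?F k"
  let ?E = "trivial_extension ?F ?M" and ?I = "{\<zero>\<^bsub>?F\<^esub>} \<times> carrier ?M"
  have M: "module ?F ?M" by (rule F.free_module)
  interpret E: cring ?E by (rule module.trivial_extension_cring[OF M])
  have cardM: "card (carrier ?M) = p ^ (l * k)" and finM: "finite (carrier ?M)"
    using GF(2,3) by (simp_all add: free_module_def card_PiE finite_PiE power_mult)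
  have finE: "finite (carrier ?E)"
    using finM GF(2) by (simp add: trivial_extension_simps)
  have cardE: "card (carrier ?E) = p ^ l * p ^ (l * k)"
    using GF(3) cardM by (simp add: trivial_extension_simps card_cartesian_product)
  obtain A :: "nat ring" where A: "ring A" "finite (carrier A)" "?E \<simeq> A"
    by (rule finite_ring_iso_nat_ring[OF E.ring_axioms finE])
  from local_ring_transport[OF trivial_extension_local[OF GF(1) M] finE A(1,3)]
  obtain \<mm> where m: "local_ring A \<mm>" "card \<mm> = card ?I" by blast
  interpret A: finite_local A \<mm> by (rule finite_localI[OF m(1) A(2)])
  have cardm: "card \<mm> = p ^ (l * k)"
    using m(2) cardM by (simp add: card_cartesian_product)
  have char: "[(p ^ 1)] \<cdot>\<^bsub>A\<^esub> \<one>\<^bsub>A\<^esub> = \<zero>\<^bsub>A\<^esub>"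
  proof -
    obtain h where "h \<in> ring_iso ?E A" using A(3) unfolding is_ring_iso_def by blast
    then have h: "h \<in> ring_hom ?E A" by (simp add: ring_iso_def)
    have g: "h \<circ> (\<lambda>a. (a, \<zero>\<^bsub>?M\<^esub>)) \<in> ring_hom ?F A"
      by (rule ring_hom_trans[OF trivial_extension_embed[OF M] h])
    have "[p] \<cdot>\<^bsub>?F\<^esub> \<one>\<^bsub>?F\<^esub> = \<zero>\<^bsub>?F\<^esub>"
      by (rule F.char_of_card[OF GF(3)]) (rule prime_gt_0_nat[OF p])
    then show ?thesis
      using ring_hom_add_pow[OF F.ring_axioms A.ring_axioms g F.one_closed, of p]
        ring_hom_one[OF g] ring_hom_zero[OF g F.ring_axioms A.ring_axioms] by simp
  qed
  from A.unit_group_structure[OF p char] obtain l'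
    where l': "units_of A \<cong> units_of (GF (p ^ l')) \<times>\<times> one_plus A \<mm>"
      "comm_group (one_plus A \<mm>)" "p_group p (one_plus A \<mm>)"
      "card (carrier (A Quot \<mm>)) = p ^ l'"
    by (elim exE conjE)
  \<comment> \<open>The structure theorem yields some exponent \<open>l'\<close>; counting elements identifies it with \<open>l\<close>.\<close>
  have "p ^ l' * p ^ (l * k) = p ^ l * p ^ (l * k)"
    using A.card_carrier l'(4) cardm cardE ring_iso_same_card[OF A(3)] by simp
  then have "p ^ l' = p ^ l" using prime_gt_0_nat[OF p] by simp
  then have "l' = l" using prime_gt_1_nat[OF p] by (simp add: power_inject_exp)
  moreover have "order (one_plus A \<mm>) = p ^ (l * k)"
    using A.order_one_plus[OF A.a_subset] cardm by simp
  moreover have "\<exists>e. ring_char A = p ^ e" by (rule A.ring_char_prime_power[OF p char])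
  ultimately show ?thesis using m(1) A(2) l' by blast
qed

theorem theorem3p1:
  shows
    "(\<forall>(p::nat) (A::('a, 'm) ring_scheme) \<mm>.
        Factorial_Ring.prime p \<and> local_ring A \<mm> \<and> finite (carrier A) \<and>
        (\<exists>e::nat. ring_char A = p ^ e) \<longrightarrow>
        (\<exists>l\<ge>1.
           (A Quot \<mm>) \<simeq> GF (p ^ l) \<and>
           subgroup (carrier (one_plus A \<mm>)) (units_of A) \<and>
           comm_group (one_plus A \<mm>) \<and> p_group p (one_plus A \<mm>) \<and>
           units_of A \<cong> units_of (GF (p ^ l)) \<times>\<times> one_plus A \<mm> \<and>
           (\<forall>i\<ge>1.
              subgroup (carrier (one_plus A (ideal_pow A \<mm> i))) (one_plus A \<mm>) \<and>
              carrier (one_plus A (ideal_pow A \<mm> (i + 1)))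
                \<subseteq> carrier (one_plus A (ideal_pow A \<mm> i)) \<and>
              (\<exists>V :: (nat, 'a set) module. is_vector_space (GF (p ^ l)) V \<and>
                 (one_plus A (ideal_pow A \<mm> i) Mod carrier (one_plus A (ideal_pow A \<mm> (i + 1))))
                   \<cong> add_monoid V)) \<and>
           (\<exists>k::nat. order (one_plus A \<mm>) = p ^ (l * k))))
     \<and>
     (\<forall>(p::nat) (l::nat) (k::nat). Factorial_Ring.prime p \<and> l \<ge> 1 \<longrightarrow>
        (\<exists>(A::nat ring) \<mm> (H::nat monoid).
           local_ring A \<mm> \<and> finite (carrier A) \<and> (\<exists>e::nat. ring_char A = p ^ e) \<and>
           comm_group H \<and> p_group p H \<and> order H = p ^ (l * k) \<and>
           units_of A \<cong> units_of (GF (p ^ l)) \<times>\<times> H))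
     \<and>
     (\<forall>G::('g, 'n) monoid_scheme. group G \<longrightarrow>
        (\<forall>(A::('b, 'r) ring_scheme) \<mm>.
           local_ring A \<mm> \<and> finite (carrier A) \<and> reduced_ring A \<and> units_of A \<cong> G \<longrightarrow>
           (\<exists>F::nat ring. field F \<and> finite (carrier F) \<and> units_of F \<cong> G)) \<and>
        (\<forall>F::('c, 's) ring_scheme.
           field F \<and> finite (carrier F) \<and> units_of F \<cong> G \<longrightarrow>
           (\<exists>(A::nat ring) \<mm>.
              local_ring A \<mm> \<and> finite (carrier A) \<and> reduced_ring A \<and> units_of A \<cong> G)))"
proof (intro conjI allI impI)
  fix p :: nat and A :: "('a, 'm) ring_scheme" and \<mm>
  assume asm: "Factorial_Ring.prime p \<and> local_ring A \<mm> \<and> finite (carrier A) \<and>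
    (\<exists>e::nat. ring_char A = p ^ e)"
  then obtain e where e: "ring_char A = p ^ e" by blast
  interpret A: finite_local A \<mm> using asm by (intro finite_localI) simp_all
  have "[(p ^ e)] \<cdot>\<^bsub>A\<^esub> \<one>\<^bsub>A\<^esub> = \<zero>\<^bsub>A\<^esub>"
    using A.ring_char_pow by (simp only: e)
  from A.unit_group_structure[OF conjunct1[OF asm] this]
  show "\<exists>l\<ge>1.
       (A Quot \<mm>) \<simeq> GF (p ^ l) \<and>
       subgroup (carrier (one_plus A \<mm>)) (units_of A) \<and>
       comm_group (one_plus A \<mm>) \<and> p_group p (one_plus A \<mm>) \<and>
       units_of A \<cong> units_of (GF (p ^ l)) \<times>\<times> one_plus A \<mm> \<and>
       (\<forall>i\<ge>1.
          subgroup (carrier (one_plus A (ideal_pow A \<mm> i))) (one_plus A \<mm>) \<and>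
          carrier (one_plus A (ideal_pow A \<mm> (i + 1)))
            \<subseteq> carrier (one_plus A (ideal_pow A \<mm> i)) \<and>
          (\<exists>V :: (nat, 'a set) module. is_vector_space (GF (p ^ l)) V \<and>
             (one_plus A (ideal_pow A \<mm> i) Mod carrier (one_plus A (ideal_pow A \<mm> (i + 1))))
               \<cong> add_monoid V)) \<and>
       (\<exists>k::nat. order (one_plus A \<mm>) = p ^ (l * k))"
    by (elim exE conjE) (intro exI conjI)
next
  fix p l k :: nat
  assume "Factorial_Ring.prime p \<and> l \<ge> 1"
  then show "\<exists>(A::nat ring) \<mm> (H::nat monoid).
    local_ring A \<mm> \<and> finite (carrier A) \<and> (\<exists>e::nat. ring_char A = p ^ e) \<and>
    comm_group H \<and> p_group p H \<and> order H = p ^ (l * k) \<and>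
    units_of A \<cong> units_of (GF (p ^ l)) \<times>\<times> H"
    by (intro exists_local_ring) simp_all
next
  fix G :: "('g, 'n) monoid_scheme" and A :: "('b, 'r) ring_scheme" and \<mm>
  assume asm: "local_ring A \<mm> \<and> finite (carrier A) \<and> reduced_ring A \<and> units_of A \<cong> G"
  interpret A: finite_local A \<mm> using asm by (intro finite_localI) simp_all
  have field: "field A" using asm by (intro A.reduced_imp_field) simp
  obtain F :: "nat ring" where F: "ring F" "finite (carrier F)" "A \<simeq> F"
    by (rule finite_ring_iso_nat_ring[OF A.ring_axioms A.finite_carrier])
  have "units_of F \<cong> units_of A"
    by (rule ring_iso_imp_units_iso[OF F(1) A.ring_axioms ring_iso_sym[OF A.ring_axioms F(3)]])
  then have "units_of F \<cong> G" using asm by (meson iso_trans)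
  then show "\<exists>F::nat ring. field F \<and> finite (carrier F) \<and> units_of F \<cong> G"
    using F(2) ring_iso_field[OF field F(1,3)] by blast
next
  fix G :: "('g, 'n) monoid_scheme" and F :: "('c, 's) ring_scheme"
  assume asm: "field F \<and> finite (carrier F) \<and> units_of F \<cong> G"
  then interpret F: field F by simp
  obtain A :: "nat ring" where A: "ring A" "finite (carrier A)" "F \<simeq> A"
    by (rule finite_ring_iso_nat_ring[OF F.ring_axioms conjunct1[OF conjunct2[OF asm]]])
  interpret A: field A by (rule ring_iso_field[OF F.field_axioms A(1,3)])
  have "units_of A \<cong> units_of F"
    by (rule ring_iso_imp_units_iso[OF A(1) F.ring_axioms ring_iso_sym[OF F.ring_axioms A(3)]])
  then have "units_of A \<cong> G" using asm by (meson iso_trans)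
  then show "\<exists>(A::nat ring) \<mm>.
      local_ring A \<mm> \<and> finite (carrier A) \<and> reduced_ring A \<and> units_of A \<cong> G"
    using A(2) A.local_ring_zero A.reduced by blast
qed

end
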